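(* Suppose that $\mathbb{T}\neq\emptyset$ and $\mathcal{R}_{\leq}\cap\mathbb{P}\neq\emptyset$. Then the maximal solution $X_M$ of the conjugate discrete-time algebraic Riccati equation $X=\mathcal{R}(X)$ exists. Furthermore, the following statements hold: (i) The sequence $\{X_k\}_{k=0}^\infty$ generated by the fixed-point iteration $X_{k+1}=\mathcal{R}(X_k)$, $k\geq 0$, with $X_0\in\mathcal{S}_{\geq}$ is well-defined. Moreover, $X_k\in\mathcal{S}_{\geq}\cap\mathbb{T}\subseteq\mathcal{R}_{\geq}\cap\mathbb{P}\cap\mathbb{T}$ for all $k\geq 0$. (ii) $X_k\geq X_{k+1}\geq X_{\mathbb{P}}$ for all $k\geq 0$ and all $X_{\mathbb{P}}\in\mathcal{R}_{\leq}\cap\mathbb{P}$. (iii) The sequence $\{X_k\}_{k=0}^\infty$ converges at least linearly to $X_M$, which is the maximal element of the set $\mathcal{R}_{\leq}\cap\mathbb{P}$ and satisfies $\rho(\widehat{T}_{X_M})\leq 1$, with the rate of convergence $$\limsup_{k\to\infty}\sqrt[k]{\|X_k-X_M\|}\leq\rho(\widehat{T}_{X_M})$$ whenever $X_M\in\mathbb{T}$.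
   Context: Let $n,m$ be positive integers and let $\mathbb{H}_\ell$ denote the set of $\ell\times\ell$ complex Hermitian matrices. For Hermitian $M,N$, $M>0$ (resp. $M\geq 0$) means positive definite (resp. positive semidefinite), and $M\geq N$ (equivalently $N\leq M$) means $M-N\geq 0$. $\overline{M}$ is the entrywise complex conjugate of $M$, $M^H$ the conjugate transpose, $\rho(M)$ the spectral radius, $\|\cdot\|$ a matrix norm, and $\widehat{M}:=\overline{M}M$; in particular $\widehat{T}_X:=\overline{T_X}\,T_X$. The maximal element of a set of Hermitian matrices is an element $Z$ of the set with $Z\geq X$ for every $X$ in the set. Fix $A\in\mathbb{C}^{n\times n}$, $B\in\mathbb{C}^{n\times m}$, $R\in\mathbb{H}_m$ nonsingular, $H\in\mathbb{H}_n$. For $X\in\mathbb{H}_n$ put $R_X:=R+B^H\overline{X}B$, and let $\mathrm{dom}(\mathcal{R}):=\{X\in\mathbb{H}_n : \det(R_X)\neq 0\}$. Define $\mathcal{R}:\mathrm{dom}(\mathcal{R})\to\mathbb{H}_n$ by $$\mathcal{R}(X):=A^H\overline{X}A-A^H\overline{X}B\,R_X^{-1}B^H\overline{X}A+H.$$ The conjugate discrete-time algebraic Riccati equation (CDARE) is $X=\mathcal{R}(X)$; with $G:=BR^{-1}B^H$ and $I$ the identity matrix, it is equivalently written $X=A^H\overline{X}(I+G\overline{X})^{-1}A+H$. A solution of the CDARE means $X\in\mathbb{H}_n$ with $R_X>0$ and $X=\mathcal{R}(X)$. The maximal solution is a solution $X_M\in\mathbb{H}_n$ such that $X_M\geq X$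 for every solution $X\in\mathbb{H}_n$ (it is unique if it exists). For $X\in\mathrm{dom}(\mathcal{R})$ put $F_X:=R_X^{-1}B^H\overline{X}A$, $T_X:=A-BF_X$, and $H_X:=H+F_X^HRF_X$. For $M\in\mathbb{C}^{n\times n}$ the conjugate Stein operator $\mathcal{C}_M:\mathbb{H}_n\to\mathbb{H}_n$ is $\mathcal{C}_M(X):=X-M^H\overline{X}M$. Define the sets $\mathcal{R}_{\leq}:=\{X\in\mathrm{dom}(\mathcal{R}): X\leq\mathcal{R}(X)\}$, $\mathcal{R}_{\geq}:=\{X\in\mathrm{dom}(\mathcal{R}): X\geq\mathcal{R}(X)\}$, $\mathbb{T}:=\{X\in\mathrm{dom}(\mathcal{R}):\rho(\widehat{T}_X)<1\}$, $\mathbb{P}:=\{X\in\mathbb{H}_n: R_X>0\}$, and, when $\mathbb{T}\neq\emptyset$, $\mathcal{S}_{\geq}:=\bigcup_{X_{\mathbb{T}}\in\mathbb{T}}\{X\in\mathbb{H}_n:\mathcal{C}_{T_{X_{\mathbb{T}}}}(X)\geq H_{X_{\mathbb{T}}}\}$. *)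

theory Defs
  imports "HOL-Analysis.Analysis"
begin

section \<open>Complex matrices\<close>

text \<open>A complex matrix with rows indexed by \<open>'n\<close> and columns by \<open>'m\<close> has type
  \<^typ>\<open>complex^'m^'n\<close>; index types are finite and nonempty, so all dimensions are positive.\<close>

definition mconj :: "complex^'m^'n \<Rightarrow> complex^'m^'n" where
  "mconj M = map_matrix cnj M"

definition conj_transpose :: "complex^'m^'n \<Rightarrow> complex^'n^'m" where
  "conj_transpose M = transpose (mconj M)"

definition mscale :: "complex \<Rightarrow> complex^'m^'n \<Rightarrow> complex^'m^'n" where
  "mscale c M = map_matrix (\<lambda>z. c * z) M"

definition hermitian :: "complex^'n^'n \<Rightarrow> bool" where
  "hermitian M \<longleftrightarrow> conj_transpose M = M"

text \<open>The value \<open>v\<^sup>H M v\<close>. It is real for Hermitian \<open>M\<close>, so only its real part is used below.\<close>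

definition quad_form :: "complex^'n^'n \<Rightarrow> complex^'n \<Rightarrow> complex" where
  "quad_form M v = (\<Sum>i\<in>UNIV. cnj (v $ i) * (M *v v) $ i)"

definition pos_semidefinite :: "complex^'n^'n \<Rightarrow> bool" where
  "pos_semidefinite M \<longleftrightarrow> hermitian M \<and> (\<forall>v. 0 \<le> Re (quad_form M v))"

definition pos_definite :: "complex^'n^'n \<Rightarrow> bool" where
  "pos_definite M \<longleftrightarrow> hermitian M \<and> (\<forall>v. v \<noteq> 0 \<longrightarrow> 0 < Re (quad_form M v))"

definition loewner_le :: "complex^'n^'n \<Rightarrow> complex^'n^'n \<Rightarrow> bool"  (infix "\<preceq>\<^sub>L" 50) where
  "M \<preceq>\<^sub>L N \<longleftrightarrow> pos_semidefinite (N - M)"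

definition maximal_element :: "(complex^'n^'n) set \<Rightarrow> complex^'n^'n \<Rightarrow> bool" where
  "maximal_element S Z \<longleftrightarrow> Z \<in> S \<and> (\<forall>X\<in>S. X \<preceq>\<^sub>L Z)"

definition matrix_spectrum :: "complex^'n^'n \<Rightarrow> complex set" where
  "matrix_spectrum M = {z. \<exists>v. v \<noteq> 0 \<and> M *v v = z *s v}"

text \<open>The maximum is over a finite nonempty set, since \<open>'n\<close> is nonempty.\<close>

definition spec_radius :: "complex^'n^'n \<Rightarrow> real" where
  "spec_radius M = Max (cmod ` matrix_spectrum M)"

text \<open>The matrix \<open>conj(M) M\<close>, usually written with a wide hat.\<close>

definition mhat :: "complex^'n^'n \<Rightarrow> complex^'n^'n" where
  "mhat M = mconj M ** M"

text \<open>An arbitrary norm on the complex vector space of square matrices. Submultiplicativity is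
  not required, so the submultiplicative norms are covered as well.\<close>

definition matrix_norm :: "(complex^'n^'n \<Rightarrow> real) \<Rightarrow> bool" where
  "matrix_norm \<nu> \<longleftrightarrow>
     (\<forall>M. 0 \<le> \<nu> M) \<and>
     (\<forall>M. \<nu> M = 0 \<longleftrightarrow> M = 0) \<and>
     (\<forall>c M. \<nu> (mscale c M) = cmod c * \<nu> M) \<and>
     (\<forall>M N. \<nu> (M + N) \<le> \<nu> M + \<nu> N)"

text \<open>The root-convergence factor \<open>limsup \<nu>(X\<^sub>k - L)\<^sup>1\<^sup>/\<^sup>k\<close> (the term for \<open>k = 0\<close> is
  irrelevant). A sequence that converges to \<open>L\<close> does so at least linearly if the factor is
  less than 1.\<close>

definition root_rate ::
    "(complex^'n^'n \<Rightarrow> real) \<Rightarrow> (nat \<Rightarrow> complex^'n^'n) \<Rightarrow> complex^'n^'n \<Rightarrow> ereal" where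
  "root_rate \<nu> X L = limsup (\<lambda>k. ereal (root k (\<nu> (X k - L))))"

definition at_least_linear ::
    "(complex^'n^'n \<Rightarrow> real) \<Rightarrow> (nat \<Rightarrow> complex^'n^'n) \<Rightarrow> complex^'n^'n \<Rightarrow> bool" where
  "at_least_linear \<nu> X L \<longleftrightarrow> (\<lambda>k. \<nu> (X k - L)) \<longlonglongrightarrow> 0 \<and> root_rate \<nu> X L < 1"


section \<open>The conjugate discrete-time algebraic Riccati equation\<close>

definition ric_R :: "complex^'m^'n \<Rightarrow> complex^'m^'m \<Rightarrow> complex^'n^'n \<Rightarrow> complex^'m^'m" where
  "ric_R B R X = R + conj_transpose B ** mconj X ** B"

definition ric_dom :: "complex^'m^'n \<Rightarrow> complex^'m^'m \<Rightarrow> (complex^'n^'n) set" where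
  "ric_dom B R = {X. hermitian X \<and> det (ric_R B R X) \<noteq> 0}"

text \<open>The Riccati operator and the matrices \<open>F\<^sub>X\<close>, \<open>T\<^sub>X\<close>, \<open>H\<^sub>X\<close> are total functions here; they are
  meaningful only for \<open>X\<close> in \<open>ric_dom B R\<close>.\<close>

definition ric_op :: "complex^'n^'n \<Rightarrow> complex^'m^'n \<Rightarrow> complex^'m^'m \<Rightarrow> complex^'n^'n
    \<Rightarrow> complex^'n^'n \<Rightarrow> complex^'n^'n" where
  "ric_op A B R H X =
     conj_transpose A ** mconj X ** A
     - conj_transpose A ** mconj X ** B ** matrix_inv (ric_R B R X)
         ** conj_transpose B ** mconj X ** A
     + H"

definition ric_F :: "complex^'n^'n \<Rightarrow> complex^'m^'n \<Rightarrow> complex^'m^'m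
    \<Rightarrow> complex^'n^'n \<Rightarrow> complex^'n^'m" where
  "ric_F A B R X = matrix_inv (ric_R B R X) ** conj_transpose B ** mconj X ** A"

definition ric_T :: "complex^'n^'n \<Rightarrow> complex^'m^'n \<Rightarrow> complex^'m^'m
    \<Rightarrow> complex^'n^'n \<Rightarrow> complex^'n^'n" where
  "ric_T A B R X = A - B ** ric_F A B R X"

definition ric_H :: "complex^'n^'n \<Rightarrow> complex^'m^'n \<Rightarrow> complex^'m^'m \<Rightarrow> complex^'n^'n
    \<Rightarrow> complex^'n^'n \<Rightarrow> complex^'n^'n" where
  "ric_H A B R H X = H + conj_transpose (ric_F A B R X) ** R ** ric_F A B R X"

definition conj_stein :: "complex^'n^'n \<Rightarrow> complex^'n^'n \<Rightarrow> complex^'n^'n" where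
  "conj_stein M X = X - conj_transpose M ** mconj X ** M"

definition cdare_solution :: "complex^'n^'n \<Rightarrow> complex^'m^'n \<Rightarrow> complex^'m^'m \<Rightarrow> complex^'n^'n
    \<Rightarrow> complex^'n^'n \<Rightarrow> bool" where
  "cdare_solution A B R H X \<longleftrightarrow>
     hermitian X \<and> pos_definite (ric_R B R X) \<and> X = ric_op A B R H X"

definition cdare_maximal_solution :: "complex^'n^'n \<Rightarrow> complex^'m^'n \<Rightarrow> complex^'m^'m
    \<Rightarrow> complex^'n^'n \<Rightarrow> complex^'n^'n \<Rightarrow> bool" where
  "cdare_maximal_solution A B R H X\<^sub>M \<longleftrightarrow>
     cdare_solution A B R H X\<^sub>M \<and> (\<forall>X. cdare_solution A B R H X \<longrightarrow> X \<preceq>\<^sub>L X\<^sub>M)"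

definition ric_le_set :: "complex^'n^'n \<Rightarrow> complex^'m^'n \<Rightarrow> complex^'m^'m \<Rightarrow> complex^'n^'n
    \<Rightarrow> (complex^'n^'n) set" where
  "ric_le_set A B R H = {X \<in> ric_dom B R. X \<preceq>\<^sub>L ric_op A B R H X}"

definition ric_ge_set :: "complex^'n^'n \<Rightarrow> complex^'m^'n \<Rightarrow> complex^'m^'m \<Rightarrow> complex^'n^'n
    \<Rightarrow> (complex^'n^'n) set" where
  "ric_ge_set A B R H = {X \<in> ric_dom B R. ric_op A B R H X \<preceq>\<^sub>L X}"

definition T_set :: "complex^'n^'n \<Rightarrow> complex^'m^'n \<Rightarrow> complex^'m^'m \<Rightarrow> (complex^'n^'n) set" where
  "T_set A B R = {X \<in> ric_dom B R. spec_radius (mhat (ric_T A B R X)) < 1}"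

definition P_set :: "complex^'m^'n \<Rightarrow> complex^'m^'m \<Rightarrow> (complex^'n^'n) set" where
  "P_set B R = {X. hermitian X \<and> pos_definite (ric_R B R X)}"

definition S_ge_set :: "complex^'n^'n \<Rightarrow> complex^'m^'n \<Rightarrow> complex^'m^'m \<Rightarrow> complex^'n^'n
    \<Rightarrow> (complex^'n^'n) set" where
  "S_ge_set A B R H =
     (\<Union>Y\<in>T_set A B R. {X. hermitian X \<and> ric_H A B R H Y \<preceq>\<^sub>L conj_stein (ric_T A B R Y) X})"

text \<open>Since \<open>ric_op\<close> is total, the iterates exist formally for every starting matrix; the
  fixed-point iteration is well-defined if all of them lie in \<open>ric_dom B R\<close>.\<close>

definition ric_iterate :: "complex^'n^'n \<Rightarrow> complex^'m^'n \<Rightarrow> complex^'m^'m \<Rightarrow> complex^'n^'n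
    \<Rightarrow> complex^'n^'n \<Rightarrow> nat \<Rightarrow> complex^'n^'n" where
  "ric_iterate A B R H X\<^sub>0 k = (ric_op A B R H ^^ k) X\<^sub>0"

end

theory Submission
  imports Defs "HOL-Computational_Algebra.Fundamental_Theorem_Algebra"
begin

text \<open>For every \<open>Y\<close> the Riccati operator satisfies
  \<open>\<R>(X) = T\<^sub>Y\<^sup>H conj(X) T\<^sub>Y + H\<^sub>Y - (F\<^sub>Y - F\<^sub>X)\<^sup>H R\<^sub>X (F\<^sub>Y - F\<^sub>X)\<close>.
  Comparing an element \<open>P\<close> of the lower set \<open>\<R>\<^sub>\<le> \<inter> \<P>\<close> with an element \<open>X\<close> of the upper set
  \<open>\<S>\<^sub>\<ge>\<close> belonging to a stable \<open>T\<^sub>Y\<close> gives a Stein inequality for \<open>X - P\<close>, hence \<open>P \<le> X\<close> and \<open>R\<^sub>X > 0\<close>; keeping the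
  quadratic defects shows that an eigenvector of \<open>mhat T\<^sub>X\<close> for an eigenvalue outside the open
  unit disc would also be one of \<open>mhat T\<^sub>Y\<close>, so \<open>X\<close> is stable as well and can replace \<open>Y\<close> to show
  that \<open>\<R>(X)\<close> is again in the upper set. The iterates thus decrease and are bounded below. For the
  limit \<open>L\<close>, the identity with \<open>Y = L\<close> gives
  \<open>X\<^sub>k\<^sub>+\<^sub>1 - L \<le> T\<^sub>L\<^sup>H conj(X\<^sub>k - L) T\<^sub>L\<close>, which yields the rate.\<close>

section \<open>Eigenvalues and powers of complex matrices\<close>

text \<open>There are \<open>DIM('a) + 1\<close> iterates in a space of dimension
  \<open>DIM('a)\<close>. Since \<open>dependent\<close> speaks of sets, repeated iterates are
  treated separately: two equal ones cancel with coefficients 1 and -1.\<close>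

lemma Krylov_dependent:
  fixes f :: "'a::euclidean_space \<Rightarrow> 'a"
  shows "\<exists>(c::nat \<Rightarrow> real) N. (\<exists>i\<le>N. c i \<noteq> 0) \<and> (\<Sum>i\<le>N. c i *\<^sub>R (f ^^ i) x) = 0"
proof (cases "inj_on (\<lambda>i. (f ^^ i) x) {..DIM('a)}")
  case True
  let ?S = "(\<lambda>i. (f ^^ i) x) ` {..DIM('a)}"
  have "card ?S = Suc DIM('a)"
    using True by (simp add: card_image)
  then have "dependent ?S"
    using independent_card_le by fastforce
  then obtain u where u: "\<exists>v\<in>?S. u v \<noteq> 0" "(\<Sum>v\<in>?S. u v *\<^sub>R v) = 0"
    using dependent_finite[of ?S] by auto
  have "(\<Sum>i\<le>DIM('a). u ((f ^^ i) x) *\<^sub>R (f ^^ i) x) = 0"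
    using u(2) by (simp add: sum.reindex[OF True])
  with u(1) show ?thesis
    by (intro exI[of _ "\<lambda>i. u ((f ^^ i) x)"] exI[of _ "DIM('a)"]) auto
next
  case False
  then obtain i j where ij: "i \<le> DIM('a)" "j \<le> DIM('a)" "i \<noteq> j" "(f ^^ i) x = (f ^^ j) x"
    by (auto simp: inj_on_def)
  let ?c = "\<lambda>k. (if k = i then 1 else 0) + (if k = j then -1 else 0) :: real"
  have "(\<Sum>k\<le>DIM('a). ?c k *\<^sub>R (f ^^ k) x) = 0"
    using ij by (simp add: scaleR_add_left sum.distrib if_distrib[of "\<lambda>a. a *\<^sub>R _"] sum.delta cong: if_cong)
  with ij show ?thesis
    by (intro exI[of _ ?c] exI[of _ "DIM('a)"]) auto
qed

text \<open>Represents p(M) v by iterating the action of M, so that linear factors can be peeled off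
  and passed to the vector.\<close>

definition poly_at :: "complex^'n^'n \<Rightarrow> complex poly \<Rightarrow> complex^'n \<Rightarrow> complex^'n" where
  "poly_at M p v = (\<Sum>i\<le>degree p. coeff p i *s (((*v) M) ^^ i) v)"

lemma poly_at_altdef:
  "degree p \<le> N \<Longrightarrow> poly_at M p v = (\<Sum>i\<le>N. coeff p i *s (((*v) M) ^^ i) v)"
  unfolding poly_at_def by (rule sum.mono_neutral_left) (auto simp: coeff_eq_0)

lemma mat_vec_mult_sum: "M *v (\<Sum>i\<in>S. f i) = (\<Sum>i\<in>S. M *v f i)" for M :: "complex^'n^'m"
  by (induction S rule: infinite_finite_induct) (auto simp: matrix_vector_right_distrib)

lemma funpow_mat_vec_diff: "((*v) M ^^ i) (u - v) = ((*v) M ^^ i) u - ((*v) M ^^ i) v"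
  for M :: "complex^'n^'n"
  by (induction i) (auto simp: matrix_vector_mult_diff_distrib)

lemma mat_vec_mult_scale: "M *v (c *s v) = c *s (M *v v)" for M :: "complex^'n^'m"
  by (simp add: vec_eq_iff matrix_vector_mult_def sum_distrib_left mult_ac)

lemma funpow_mat_vec_scale: "((*v) M ^^ i) (c *s v) = c *s ((*v) M ^^ i) v"
  for M :: "complex^'n^'n"
  by (induction i) (auto simp: mat_vec_mult_scale)

text \<open>M - a commutes with p(M). Applying it first yields a new annihilated vector for
  inductions; applying it last allows cancelling it when a is not an eigenvalue.\<close>

lemma poly_at_linear_factor:
  fixes M :: "complex^'n^'n"
  shows "poly_at M ([:-a, 1:] * p) v = poly_at M p (M *v v - a *s v)"
    and "poly_at M ([:-a, 1:] * p) v = M *v poly_at M p v - a *s poly_at M p v"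
proof -
  let ?N = "degree p" and ?P = "\<lambda>i. ((*v) M ^^ i)"
  have "degree ([:-a, 1:] * p) \<le> Suc ?N"
    by (rule order_trans[OF degree_mult_le]) simp
  then have "poly_at M ([:-a, 1:] * p) v = (\<Sum>i\<le>Suc ?N. coeff ([:-a, 1:] * p) i *s ?P i v)"
    by (rule poly_at_altdef)
  \<comment> \<open>Coefficient i of (x - a) p is
    \<open>coeff (pCons 0 p) i - a * coeff p i\<close>. Summing to \<open>Suc ?N\<close> keeps the
    top term of the shifted part.\<close>
  also have "\<dots> = (\<Sum>i\<le>Suc ?N. coeff (pCons 0 p) i *s ?P i v) - (\<Sum>i\<le>Suc ?N. a *s (coeff p i *s ?P i v))"
    by (simp add: sum_subtractf[symmetric] vector_add_ldistrib algebra_simps vec_eq_iff del: sum.atMost_Suc)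
  also have "(\<Sum>i\<le>Suc ?N. coeff (pCons 0 p) i *s ?P i v) = (\<Sum>i\<le>?N. coeff p i *s ?P (Suc i) v)"
    by (subst sum.atMost_Suc_shift) simp
  also have "(\<Sum>i\<le>Suc ?N. a *s (coeff p i *s ?P i v)) = (\<Sum>i\<le>?N. a *s (coeff p i *s ?P i v))"
    by (simp add: coeff_eq_0)
  finally have *: "poly_at M ([:-a, 1:] * p) v
      = (\<Sum>i\<le>?N. coeff p i *s ?P (Suc i) v) - (\<Sum>i\<le>?N. a *s (coeff p i *s ?P i v))" .
  show "poly_at M ([:-a, 1:] * p) v = M *v poly_at M p v - a *s poly_at M p v"
    unfolding * unfolding poly_at_def
    by (simp add: mat_vec_mult_sum mat_vec_mult_scale vec_eq_iff sum_distrib_left mult.assoc)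
  show "poly_at M ([:-a, 1:] * p) v = poly_at M p (M *v v - a *s v)"
    unfolding * unfolding poly_at_def funpow_mat_vec_diff funpow_mat_vec_scale sum_subtractf[symmetric]
    by (intro sum.cong refl) (simp add: vec_eq_iff algebra_simps funpow_Suc_right del: funpow.simps)
qed

text \<open>The powers of M, obtained by iterating left multiplication on \<open>mat 1\<close>, live
  in a finite-dimensional real space and so satisfy a real linear relation. This dimension count
  stands in for the Cayley-Hamilton theorem.\<close>

lemma annihilating_poly:
  fixes M :: "complex^'n^'n"
  obtains p where "p \<noteq> 0" "\<And>v. poly_at M p v = 0"
proof -
  obtain c :: "nat \<Rightarrow> real" and N where c: "\<exists>i\<le>N. c i \<noteq> 0"
    "(\<Sum>i\<le>N. c i *\<^sub>R ((**) M ^^ i) (mat 1)) = 0"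
    using Krylov_dependent[of "(**) M" "mat 1"] by blast
  define p where "p = (\<Sum>i\<le>N. monom (complex_of_real (c i)) i)"
  have coeff_p: "coeff p i = (if i \<le> N then of_real (c i) else 0)" for i
    unfolding p_def coeff_sum by (simp add: sum.delta)
  have "p \<noteq> 0"
    using c(1) coeff_p by (metis coeff_0 of_real_eq_0_iff)
  moreover have "poly_at M p v = 0" for v
  proof -
    have deg: "degree p \<le> N"
      by (rule degree_le) (simp add: coeff_p)
    have pw: "(((**) M ^^ i) (mat 1)) *v v = ((*v) M ^^ i) v" for i
      by (induction i) (auto simp: matrix_vector_mul_assoc[symmetric])
    have "poly_at M p v = (\<Sum>i\<le>N. (c i *\<^sub>R ((**) M ^^ i) (mat 1)) *v v)"
      unfolding poly_at_altdef[OF deg] pw[symmetric]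
      by (intro sum.cong refl)
        (simp add: vec_eq_iff matrix_vector_mult_def coeff_p sum_distrib_left, simp add: scaleR_conv_of_real mult_ac)
    also have "\<dots> = (\<Sum>i\<le>N. c i *\<^sub>R ((**) M ^^ i) (mat 1)) *v v"
      by (induction N) (auto simp: matrix_vector_mult_add_rdistrib)
    finally show ?thesis
      by (simp add: c(2))
  qed
  ultimately show ?thesis
    using that by blast
qed

lemma poly_at_const: "degree p = 0 \<Longrightarrow> poly_at M p v = coeff p 0 *s v"
  by (simp add: poly_at_def)

lemma complex_poly_factor:
  fixes p :: "complex poly"
  assumes "degree p = Suc d"
  obtains a q where "p = [:-a, 1:] * q" "degree q = d" "q \<noteq> 0"
proof -
  have "\<not> constant (poly p)"
    using assms by (simp add: constant_degree)
  then obtain a where "poly p a = 0"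
    using fundamental_theorem_of_algebra by blast
  then obtain q where q: "p = [:-a, 1:] * q"
    by (auto simp: poly_eq_0_iff_dvd)
  have "q \<noteq> 0" using assms q by auto
  moreover have "degree q = d"
    using assms \<open>q \<noteq> 0\<close> unfolding q by (simp add: degree_mult_eq del: mult_pCons_left)
  ultimately show ?thesis using that q by blast
qed

text \<open>Linear factors are peeled off one by one: either x - a kills v, which is then an
  eigenvector, or (M - a) v is a nonzero vector annihilated by the quotient, of smaller
  degree.\<close>

lemma eigenvalue_exists_annihilated:
  fixes M :: "complex^'n^'n"
  assumes "p \<noteq> 0" "poly_at M p v = 0" "v \<noteq> 0"
  shows "matrix_spectrum M \<noteq> {}"
  using assms
proof (induction "degree p" arbitrary: p v)
  case 0
  then have "coeff p 0 *s v = 0" "coeff p 0 \<noteq> 0"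
    using leading_coeff_0_iff[of p] by (simp_all add: poly_at_const)
  with 0 show ?case by (auto simp: vec_eq_iff)
next
  case (Suc d)
  from Suc(2) obtain a q where q: "p = [:-a, 1:] * q" "degree q = d" "q \<noteq> 0"
    by (metis complex_poly_factor)
  show ?case
  proof (cases "M *v v - a *s v = 0")
    case True
    with \<open>v \<noteq> 0\<close> show ?thesis by (auto simp: matrix_spectrum_def)
  next
    case False
    have "poly_at M q (M *v v - a *s v) = 0"
      using Suc.prems(2) unfolding q(1) poly_at_linear_factor(1) .
    with Suc.hyps(1) q False show ?thesis by blast
  qed
qed

lemma matrix_spectrum_nonempty: "matrix_spectrum M \<noteq> {}"
proof -
  obtain p where "p \<noteq> 0" "\<And>v. poly_at M p v = 0"
    using annihilating_poly by blast
  then show ?thesis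
    using eigenvalue_exists_annihilated[of p M "axis undefined 1"] by (simp add: axis_eq_0_iff)
qed

text \<open>On an eigenvector for z, p(M) acts as p(z), so every eigenvalue is a root of one fixed
  annihilating polynomial.\<close>

lemma finite_matrix_spectrum: "finite (matrix_spectrum M)"
proof -
  obtain p where p: "p \<noteq> 0" "\<And>v. poly_at M p v = 0"
    using annihilating_poly by blast
  have "matrix_spectrum M \<subseteq> {z. poly p z = 0}"
  proof
    fix z assume "z \<in> matrix_spectrum M"
    then obtain v where v: "v \<noteq> 0" "M *v v = z *s v"
      by (auto simp: matrix_spectrum_def)
    have "((*v) M ^^ i) v = z ^ i *s v" for i
      by (induction i) (simp_all add: mat_vec_mult_scale v(2) vector_smult_assoc mult.commute)
    then have "poly_at M p v = poly p z *s v"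
      by (simp add: poly_at_def poly_altdef vec_eq_iff sum_distrib_right mult.assoc)
    with p v show "z \<in> {z. poly p z = 0}" by auto
  qed
  then show ?thesis
    using poly_roots_finite[OF p(1)] finite_subset by blast
qed

lemma spec_radius_less_iff: "spec_radius M < s \<longleftrightarrow> (\<forall>z\<in>matrix_spectrum M. cmod z < s)"
  unfolding spec_radius_def
  by (subst Max_less_iff) (auto simp: finite_matrix_spectrum matrix_spectrum_nonempty)

lemma spec_radius_le_iff: "spec_radius M \<le> s \<longleftrightarrow> (\<forall>z\<in>matrix_spectrum M. cmod z \<le> s)"
  unfolding spec_radius_def
  by (subst Max_le_iff) (auto simp: finite_matrix_spectrum matrix_spectrum_nonempty)

lemma spec_radius_nonneg: "0 \<le> spec_radius M"
proof -
  obtain z where "z \<in> matrix_spectrum M"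
    using matrix_spectrum_nonempty by blast
  then show ?thesis
    using spec_radius_le_iff[of M "spec_radius M"] by (meson norm_ge_zero order.refl order.trans)
qed

section \<open>Growth of matrix powers\<close>

lemma norm_vec_scale: "norm (c *s v) = cmod c * norm v" for v :: "complex^'n"
  by (simp add: norm_vec_def L2_set_def norm_mult power_mult_distrib sum_distrib_left[symmetric] real_sqrt_mult)

lemma power_growth_annihilated:
  fixes M :: "complex^'n^'n"
  assumes "\<forall>z\<in>matrix_spectrum M. cmod z < s" "0 < s" "p \<noteq> 0" "poly_at M p v = 0"
  shows "\<exists>C. \<forall>k. norm (((*v) M ^^ k) v) \<le> C * s ^ k"
  using assms(3,4)
proof (induction "degree p" arbitrary: p v)
  case 0
  then have "coeff p 0 *s v = 0" "coeff p 0 \<noteq> 0"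
    using leading_coeff_0_iff[of p] by (simp_all add: poly_at_const)
  then have v: "v = 0" by (auto simp: vec_eq_iff)
  have "((*v) M ^^ k) v = 0" for k
    unfolding v by (induction k) auto
  then show ?case by (intro exI[of _ 0]) auto
next
  case (Suc d)
  from Suc(2) obtain a q where q: "p = [:-a, 1:] * q" "degree q = d" "q \<noteq> 0"
    by (metis complex_poly_factor)
  show ?case
  proof (cases "a \<in> matrix_spectrum M")
    case True
    then have a: "cmod a < s" using assms(1) by auto
    let ?w = "M *v v - a *s v"
    have "poly_at M q ?w = 0"
      using Suc.prems(2) unfolding q(1) poly_at_linear_factor(1) .
    with Suc.hyps(1) q obtain C where C: "\<And>k. norm (((*v) M ^^ k) ?w) \<le> C * s ^ k"
      by blast
    \<comment> \<open>\<open>norm v\<close> settles k = 0; \<open>C / (s - cmod a)\<close> gives |a|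
      C' + C \<le> s C', which closes the induction step.\<close>
    define C' where "C' = max (norm v) (C / (s - cmod a))"
    have C': "C \<le> C' * (s - cmod a)"
      using a by (simp add: C'_def field_simps max_def)
    have "norm (((*v) M ^^ k) v) \<le> C' * s ^ k" for k
    proof (induction k)
      case 0
      then show ?case by (simp add: C'_def)
    next
      case (Suc k)
      have "((*v) M ^^ Suc k) v = a *s ((*v) M ^^ k) v + ((*v) M ^^ k) ?w"
        unfolding funpow_mat_vec_diff funpow_mat_vec_scale
        by (simp add: funpow_Suc_right del: funpow.simps)
      then have "norm (((*v) M ^^ Suc k) v) \<le> cmod a * norm (((*v) M ^^ k) v) + norm (((*v) M ^^ k) ?w)"
        by (metis norm_triangle_ineq norm_vec_scale)
      also have "\<dots> \<le> cmod a * (C' * s ^ k) + C * s ^ k"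
        using Suc C by (intro add_mono mult_left_mono) auto
      also have "\<dots> \<le> cmod a * (C' * s ^ k) + C' * (s - cmod a) * s ^ k"
        using C' \<open>0 < s\<close> by (intro add_left_mono mult_right_mono) auto
      also have "\<dots> = C' * s ^ Suc k" by (simp add: algebra_simps)
      finally show ?case .
    qed
    then show ?thesis by blast
  next
    case False
    have "M *v poly_at M q v - a *s poly_at M q v = 0"
      using Suc.prems(2) unfolding q(1) poly_at_linear_factor(2) .
    with False have "poly_at M q v = 0"
      by (auto simp: matrix_spectrum_def)
    with Suc.hyps(1) q show ?thesis by blast
  qed
qed

lemma power_growth:
  fixes M :: "complex^'n^'n"
  assumes "spec_radius M < s"
  shows "\<exists>C. \<forall>k. norm (((*v) M ^^ k) v) \<le> C * s ^ k"
proof -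
  obtain p where "p \<noteq> 0" "\<And>v. poly_at M p v = 0"
    using annihilating_poly by blast
  moreover have "0 < s" using assms spec_radius_nonneg[of M] by linarith
  ultimately show ?thesis
    using power_growth_annihilated[of M s p v] assms by (auto simp: spec_radius_less_iff)
qed

section \<open>Spectral radius under limits\<close>

lemma tendsto_det:
  fixes f :: "'b \<Rightarrow> complex^'n^'n"
  assumes "(f \<longlongrightarrow> M) F"
  shows "((\<lambda>x. det (f x)) \<longlongrightarrow> det M) F"
  unfolding det_def by (intro tendsto_intros tendsto_vec_nth assms)

text \<open>The reversed characteristic polynomial \<open>det (I - z M)\<close>: unlike for the characteristic
  polynomial itself, normalization at \<open>z = 0\<close> is immediate.\<close>

definition rcharpoly :: "complex^'n^'n \<Rightarrow> complex poly" where
  "rcharpoly M = det (\<chi> i j. [:if i = j then 1 else 0, - (M $ i $ j):])"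

lemma poly_rcharpoly: "poly (rcharpoly M) z = det (mat 1 - mscale z M)"
proof -
  have "poly (of_int i) z = of_int i" for i
    by (cases i) auto
  then show ?thesis
    by (simp add: rcharpoly_def det_def mscale_def map_matrix_def poly_sum poly_prod mat_def
        if_distrib[of "\<lambda>a. poly a z"] cong: if_cong)
qed

lemma degree_rcharpoly: "degree (rcharpoly (M :: complex^'n^'n)) \<le> CARD('n)"
  unfolding rcharpoly_def det_def
proof (intro degree_sum_le finite_permutations finite, goal_cases)
  case (1 p)
  let ?N = "\<chi> i j. [:if i = j then 1 else 0, - (M $ i $ j):]"
  have "degree (\<Prod>i\<in>UNIV. ?N $ i $ p i) \<le> sum (degree \<circ> (\<lambda>i. ?N $ i $ p i)) UNIV"
    by (rule degree_prod_sum_le) simp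
  also have "\<dots> \<le> (\<Sum>i\<in>(UNIV::'n set). 1)"
    by (intro sum_mono) simp
  finally have "degree (\<Prod>i\<in>UNIV. ?N $ i $ p i) \<le> CARD('n)" by simp
  then show ?case by (auto simp: sign_def)
qed

text \<open>Each root a satisfies |z - a| \<ge> |a| - |z| \<ge> |a| (1 - |z|), and the factors |a|
  recombine to |p(0)|. Letting d exceed the degree gives one exponent for all matrices of a given
  size.\<close>

lemma poly_lower_bound:
  fixes p :: "complex poly"
  assumes "\<And>w. poly p w = 0 \<Longrightarrow> 1 < cmod w" "cmod z < 1" "degree p \<le> d"
  shows "cmod (poly p 0) * (1 - cmod z) ^ d \<le> cmod (poly p z)"
  using assms(1,3)
proof (induction d arbitrary: p)
  case 0
  then obtain c where "p = [:c:]" by (metis degree_eq_zeroE le_zero_eq)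
  then show ?case by simp
next
  case (Suc d)
  have z: "0 \<le> 1 - cmod z" "1 - cmod z \<le> 1" using assms(2) by auto
  show ?case
  proof (cases "degree p = Suc d")
    case False
    then have "cmod (poly p 0) * (1 - cmod z) ^ d \<le> cmod (poly p z)"
      using Suc by auto
    moreover have "cmod (poly p 0) * (1 - cmod z) ^ Suc d \<le> cmod (poly p 0) * (1 - cmod z) ^ d"
      using z by (intro mult_left_mono power_decreasing) auto
    ultimately show ?thesis by linarith
  next
    case True
    then obtain a q where q: "p = [:-a, 1:] * q" "degree q = d" "q \<noteq> 0"
      by (metis complex_poly_factor)
    have a: "1 < cmod a" using Suc.prems(1)[of a] q by simp
    have IH: "cmod (poly q 0) * (1 - cmod z) ^ d \<le> cmod (poly q z)"
      using Suc q by auto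
    have "cmod z \<le> cmod a * cmod z"
      using a by (simp add: mult_le_cancel_right1)
    then have "cmod a * (1 - cmod z) \<le> cmod a - cmod z"
      by (simp add: algebra_simps)
    also have "\<dots> \<le> cmod (z - a)"
      using norm_triangle_ineq2[of a z] by (simp add: norm_minus_commute)
    finally have "cmod a * (1 - cmod z) \<le> cmod (z - a)" .
    then have "(cmod a * (1 - cmod z)) * (cmod (poly q 0) * (1 - cmod z) ^ d)
        \<le> cmod (z - a) * cmod (poly q z)"
      using IH z by (intro mult_mono) auto
    then show ?thesis
      by (simp add: q(1) norm_mult[symmetric] algebra_simps)
        (simp add: norm_mult algebra_simps norm_minus_commute)
  qed
qed

lemma mscale_mult_vec: "mscale z M *v v = z *s (M *v v)"
  by (simp add: vec_eq_iff mscale_def map_matrix_def matrix_vector_mult_def sum_distrib_left mult.assoc)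

lemma det_eq_0_iff_kernel: "det M = 0 \<longleftrightarrow> (\<exists>v. v \<noteq> 0 \<and> M *v v = 0)" for M :: "complex^'n^'n"
  using invertible_det_nz[of M] invertible_left_inverse[of M] matrix_left_invertible_ker[of M] by blast

lemma rcharpoly_eq_0_iff:
  "poly (rcharpoly M) z = 0 \<longleftrightarrow> z \<noteq> 0 \<and> 1 / z \<in> matrix_spectrum M"
proof -
  have "(mat 1 - mscale z M) *v v = 0 \<longleftrightarrow> z \<noteq> 0 \<and> M *v v = (1 / z) *s v" if "v \<noteq> 0" for v
    using that by (auto simp: matrix_vector_mult_diff_rdistrib mscale_mult_vec vec_eq_iff field_simps)
  then show ?thesis
    unfolding poly_rcharpoly det_eq_0_iff_kernel matrix_spectrum_def by blast
qed

text \<open>An eigenvalue z of L outside the closed disc would make w = 1/z a root of the limit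
  polynomial inside the disc. Stability of every \<open>M k\<close> bounds the polynomials at w
  below by a positive number independent of k, which contradicts continuity of the
  determinant.\<close>

lemma spec_radius_limit_le_1:
  fixes M :: "nat \<Rightarrow> complex^'n^'n"
  assumes lim: "M \<longlonglongrightarrow> L" and M: "\<And>k. spec_radius (M k) < 1"
  shows "spec_radius L \<le> 1"
  unfolding spec_radius_le_iff
proof (rule ballI, rule ccontr)
  fix z assume z: "z \<in> matrix_spectrum L" "\<not> cmod z \<le> 1"
  define w where "w = 1 / z"
  have w: "cmod w < 1" "w \<noteq> 0" using z(2) by (auto simp: w_def norm_divide divide_less_eq)
  have "poly (rcharpoly L) w = 0"
    using z w by (simp add: rcharpoly_eq_0_iff) (simp add: w_def)
  moreover have "(\<lambda>k. poly (rcharpoly (M k)) w) \<longlonglongrightarrow> poly (rcharpoly L) w"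
    unfolding poly_rcharpoly mscale_def map_matrix_def
    by (intro tendsto_det tendsto_diff tendsto_const vec_tendstoI)
      (auto intro!: tendsto_intros tendsto_vec_nth lim)
  ultimately have "(\<lambda>k. cmod (poly (rcharpoly (M k)) w)) \<longlonglongrightarrow> 0"
    using tendsto_norm_zero by fastforce
  moreover have "(1 - cmod w) ^ CARD('n) \<le> cmod (poly (rcharpoly (M k)) w)" for k
  proof -
    have "1 < cmod u" if "poly (rcharpoly (M k)) u = 0" for u
      using that M[of k] by (auto simp: rcharpoly_eq_0_iff spec_radius_less_iff norm_divide divide_less_eq)
    moreover have "poly (rcharpoly (M k)) 0 = 1"
      by (simp add: poly_rcharpoly mscale_def map_matrix_def zero_vec_def[symmetric])
    ultimately show ?thesis
      using poly_lower_bound[of "rcharpoly (M k)" w "CARD('n)"] w degree_rcharpoly[of "M k"] by auto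
  qed
  ultimately have "(1 - cmod w) ^ CARD('n) \<le> 0"
    by (intro LIMSEQ_le_const) auto
  then show False using zero_less_power[of "1 - cmod w" "CARD('n)"] w by linarith
qed


section \<open>Hermitian forms\<close>

definition vcnj :: "complex^'n \<Rightarrow> complex^'n" where
  "vcnj v = (\<chi> i. cnj (v $ i))"

definition cip :: "complex^'n \<Rightarrow> complex^'n \<Rightarrow> complex" where
  "cip u v = (\<Sum>i\<in>UNIV. cnj (u $ i) * v $ i)"

text \<open>Order, definiteness and equality of Hermitian matrices are all tested on these real
  values; the Riccati argument works with them pointwise.\<close>

definition rquad :: "complex^'n^'n \<Rightarrow> complex^'n \<Rightarrow> real" where
  "rquad M v = Re (quad_form M v)"

lemma quad_form_cip: "quad_form M v = cip v (M *v v)"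
  by (simp add: quad_form_def cip_def)

lemma matrix_mult_add_rdistrib: "(A + B) ** C = A ** C + B ** C"
  for A B :: "complex^'m^'n"
  by (simp add: vec_eq_iff matrix_matrix_mult_def algebra_simps sum.distrib)

lemma cip_simps [simp]:
  "cip (u + v) w = cip u w + cip v w" "cip u (v + w) = cip u v + cip u w"
  "cip (u - v) w = cip u w - cip v w" "cip u (v - w) = cip u v - cip u w"
  "cip (c *s u) v = cnj c * cip u v" "cip u (c *s v) = c * cip u v"
  "cip 0 v = 0" "cip u 0 = 0"
  by (simp_all add: cip_def algebra_simps sum.distrib sum_subtractf sum_distrib_left)

lemma cip_vcnj: "cip (vcnj u) (vcnj v) = cnj (cip u v)"
  by (simp add: cip_def vcnj_def)

lemma cip_conj_transpose: "cip (M *v u) v = cip u (conj_transpose M *v v)"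
proof -
  have "cip (M *v u) v = (\<Sum>i\<in>UNIV. \<Sum>j\<in>UNIV. cnj (M $ i $ j) * cnj (u $ j) * v $ i)"
    by (simp add: cip_def matrix_vector_mult_def sum_distrib_right)
  also have "\<dots> = (\<Sum>j\<in>UNIV. \<Sum>i\<in>UNIV. cnj (M $ i $ j) * cnj (u $ j) * v $ i)"
    by (rule sum.swap)
  also have "\<dots> = cip u (conj_transpose M *v v)"
    by (simp add: cip_def matrix_vector_mult_def conj_transpose_def mconj_def map_matrix_def
        transpose_def sum_distrib_left mult_ac)
  finally show ?thesis .
qed

lemma cip_hermitian: "hermitian M \<Longrightarrow> cip (M *v u) v = cip u (M *v v)"
  by (simp add: cip_conj_transpose hermitian_def)

lemma vcnj_simps [simp]:
  "vcnj (u + v) = vcnj u + vcnj v" "vcnj (u - v) = vcnj u - vcnj v"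
  "vcnj (c *s u) = cnj c *s vcnj u" "vcnj (vcnj u) = u" "vcnj 0 = 0"
  by (simp_all add: vcnj_def vec_eq_iff)

lemma mconj_simps [simp]:
  "mconj (mconj M) = M" "mconj (M + N) = mconj M + mconj N" "mconj (M - N) = mconj M - mconj N"
  by (simp_all add: mconj_def map_matrix_def vec_eq_iff)

lemma mconj_mult_vec: "mconj M *v v = vcnj (M *v vcnj v)"
  by (simp add: mconj_def map_matrix_def vec_eq_iff matrix_vector_mult_def vcnj_def)

lemma conj_transpose_simps [simp]:
  "conj_transpose (conj_transpose M) = M"
  "conj_transpose (M + N) = conj_transpose M + conj_transpose N"
  "conj_transpose (M - N) = conj_transpose M - conj_transpose N"
  "conj_transpose (mconj M) = mconj (conj_transpose M)"
  "conj_transpose (mat 1) = mat 1"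
  by (auto simp: conj_transpose_def mconj_def map_matrix_def vec_eq_iff transpose_def mat_def)

lemma conj_transpose_mult: "conj_transpose (M ** N) = conj_transpose N ** conj_transpose M"
  by (simp add: conj_transpose_def mconj_def map_matrix_def vec_eq_iff matrix_matrix_mult_def
      transpose_def mult.commute)

lemma hermitian_add: "hermitian M \<Longrightarrow> hermitian N \<Longrightarrow> hermitian (M + N)"
  and hermitian_diff: "hermitian M \<Longrightarrow> hermitian N \<Longrightarrow> hermitian (M - N)"
  and hermitian_mconj: "hermitian M \<Longrightarrow> hermitian (mconj M)"
  and hermitian_congruence: "hermitian M \<Longrightarrow> hermitian (conj_transpose P ** M ** P)"
  by (simp_all add: hermitian_def conj_transpose_mult matrix_mul_assoc)

lemma matrix_inv_mult:
  assumes "invertible M"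
  shows "M ** matrix_inv M = mat 1" "matrix_inv M ** M = mat 1"
  using someI_ex[OF assms[unfolded invertible_def]] by (simp_all add: matrix_inv_def)

lemma hermitian_matrix_inv:
  assumes "hermitian M" "invertible M"
  shows "hermitian (matrix_inv M)"
proof -
  have *: "M ** matrix_inv M = mat 1" "matrix_inv M ** M = mat 1"
    using assms(2) by (rule matrix_inv_mult)+
  have "conj_transpose (matrix_inv M) ** M = mat 1"
    using arg_cong[OF *(1), of conj_transpose] assms(1)
    by (simp add: conj_transpose_mult hermitian_def)
  then have "conj_transpose (matrix_inv M) ** (M ** matrix_inv M) = matrix_inv M"
    by (simp add: matrix_mul_assoc)
  then show ?thesis by (simp add: * hermitian_def)
qed

lemma hermitian_component: "hermitian M \<Longrightarrow> M $ j $ i = cnj (M $ i $ j)"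
  unfolding hermitian_def conj_transpose_def mconj_def map_matrix_def transpose_def vec_eq_iff
  by (metis (no_types, lifting) vec_lambda_beta)

lemma closed_hermitian: "closed {M :: complex^'n^'n. hermitian M}"
  unfolding hermitian_def conj_transpose_def mconj_def map_matrix_def transpose_def
  by (intro closed_Collect_eq continuous_intros)

lemma rquad_simps [simp]:
  "rquad (M + N) v = rquad M v + rquad N v" "rquad (M - N) v = rquad M v - rquad N v"
  "rquad 0 v = 0" "rquad M 0 = 0"
  by (simp_all add: rquad_def quad_form_cip algebra_simps)

lemma rquad_scale: "rquad M (c *s v) = (cmod c)\<^sup>2 * rquad M v"
  by (simp add: rquad_def quad_form_cip mat_vec_mult_scale cmod_power2)
    (simp add: algebra_simps power2_eq_square)

lemma rquad_mconj: "rquad (mconj M) v = rquad M (vcnj v)"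
proof -
  have "cip v (mconj M *v v) = cnj (cip (vcnj v) (M *v vcnj v))"
    unfolding mconj_mult_vec by (metis cip_vcnj vcnj_simps(4))
  then show ?thesis by (simp add: rquad_def quad_form_cip)
qed

lemma rquad_congruence: "rquad (conj_transpose P ** M ** P) v = rquad M (P *v v)"
  by (simp add: rquad_def quad_form_cip cip_conj_transpose matrix_vector_mul_assoc matrix_mul_assoc)

text \<open>Polarization. Equality, convergence and norm bounds for Hermitian matrices thereby
  reduce to the form at finitely many vectors.\<close>

lemma hermitian_entry:
  assumes "hermitian M"
  shows "M $ i $ j = Complex
    ((rquad M (axis i 1 + axis j 1) - rquad M (axis i 1) - rquad M (axis j 1)) / 2)
    ((rquad M (axis i 1) + rquad M (axis j 1) - rquad M (axis i 1 + \<i> *s axis j 1)) / 2)"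
proof -
  have e: "cip (axis k 1) (M *v axis l 1) = M $ k $ l" for k l
    by (simp add: cip_def axis_def matrix_vector_mult_def if_distrib[of cnj] if_distrib[of "\<lambda>a. a * _"]
        if_distrib[of "\<lambda>a. _ * a"] sum.delta cong: if_cong)
  have ij: "M $ j $ i = cnj (M $ i $ j)"
    using assms by (rule hermitian_component)
  show ?thesis
    by (simp add: rquad_def quad_form_cip matrix_vector_right_distrib mat_vec_mult_scale e ij complex_eq_iff)
qed

lemma hermitian_eqI:
  assumes "hermitian M" "hermitian N" "\<And>v. rquad M v = rquad N v"
  shows "M = N"
  using assms by (simp add: vec_eq_iff hermitian_entry[of M] hermitian_entry[of N])

lemma rquad_bound: "\<exists>C\<ge>0. \<forall>v. \<bar>rquad M v\<bar> \<le> C * (norm v)\<^sup>2" for M :: "complex^'n^'n"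
proof -
  obtain K where K: "\<And>v. norm (M *v v) \<le> norm v * K" "0 < K"
    using bounded_linear.pos_bounded[of "(*v) M"] by auto
  have "\<bar>rquad M v\<bar> \<le> CARD('n) * K * (norm v)\<^sup>2" for v
  proof -
    have "\<bar>rquad M v\<bar> \<le> cmod (cip v (M *v v))"
      unfolding rquad_def quad_form_cip by (rule abs_Re_le_cmod)
    also have "\<dots> \<le> (\<Sum>i\<in>UNIV. cmod (cnj (v $ i) * (M *v v) $ i))"
      unfolding cip_def by (rule norm_sum)
    also have "\<dots> \<le> (\<Sum>i\<in>(UNIV::'n set). norm v * (norm v * K))"
    proof (rule sum_mono)
      fix i
      have "cmod (v $ i) \<le> norm v" "cmod ((M *v v) $ i) \<le> norm v * K"
        using Finite_Cartesian_Product.norm_nth_le[of v i]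
          Finite_Cartesian_Product.norm_nth_le[of "M *v v" i] K(1)[of v] by linarith+
      then show "cmod (cnj (v $ i) * (M *v v) $ i) \<le> norm v * (norm v * K)"
        by (simp add: norm_mult mult_mono)
    qed
    finally show ?thesis by (simp add: power2_eq_square mult_ac)
  qed
  then show ?thesis using K(2) by (intro exI[of _ "CARD('n) * K"]) auto
qed

lemma rquad_tendsto:
  assumes "(f \<longlongrightarrow> M) F"
  shows "((\<lambda>x. rquad (f x) v) \<longlongrightarrow> rquad M v) F"
  unfolding rquad_def quad_form_def matrix_vector_mult_def vec_lambda_beta
  by (intro tendsto_intros assms)

text \<open>By polarization the pointwise limits q of the forms determine all entries, so L is
  assembled from q.\<close>

lemma hermitian_tendsto:
  fixes X :: "nat \<Rightarrow> complex^'n^'n"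
  assumes "\<And>k. hermitian (X k)" "\<And>v. convergent (\<lambda>k. rquad (X k) v)"
  obtains L where "X \<longlonglongrightarrow> L" "hermitian L"
proof -
  from assms(2) obtain q where q: "\<And>v. (\<lambda>k. rquad (X k) v) \<longlonglongrightarrow> q v"
    unfolding convergent_def by metis
  define L where "L = (\<chi> i j. Complex
    ((q (axis i 1 + axis j 1) - q (axis i 1) - q (axis j 1)) / 2)
    ((q (axis i 1) + q (axis j 1) - q (axis i 1 + \<i> *s axis j 1)) / 2))"
  have "X \<longlonglongrightarrow> L"
    unfolding L_def
  proof (intro vec_tendstoI)
    fix i j
    show "(\<lambda>k. X k $ i $ j) \<longlonglongrightarrow> (\<chi> i j. Complex
    ((q (axis i 1 + axis j 1) - q (axis i 1) - q (axis j 1)) / 2)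
    ((q (axis i 1) + q (axis j 1) - q (axis i 1 + \<i> *s axis j 1)) / 2)) $ i $ j"
      unfolding hermitian_entry[OF assms(1), of _ i j] vec_lambda_beta
      by (intro tendsto_Complex tendsto_intros q) auto
  qed
  moreover have "hermitian L"
    using closed_sequentially[OF closed_hermitian, of X L] assms(1) calculation by auto
  ultimately show ?thesis using that by blast
qed

lemma loewner_le_iff:
  "hermitian M \<Longrightarrow> hermitian N \<Longrightarrow> M \<preceq>\<^sub>L N \<longleftrightarrow> (\<forall>v. rquad M v \<le> rquad N v)"
  by (simp add: loewner_le_def pos_semidefinite_def hermitian_diff rquad_def[symmetric])

lemma pos_definite_iff:
  "pos_definite M \<longleftrightarrow> hermitian M \<and> (\<forall>v. v \<noteq> 0 \<longrightarrow> 0 < rquad M v)"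
  by (simp add: pos_definite_def rquad_def)

lemma pos_definite_rquad:
  assumes "pos_definite M"
  shows "0 \<le> rquad M v" "rquad M v = 0 \<Longrightarrow> v = 0"
  using assms by (cases "v = 0"; force simp: pos_definite_iff)+

lemma pos_definite_det: "pos_definite M \<Longrightarrow> det M \<noteq> 0"
  using pos_definite_rquad(2)[of M] by (auto simp: det_eq_0_iff_kernel rquad_def quad_form_cip)

text \<open>Cramer's rule for column l of the inverse. As quotients of determinants, the entries of
  the inverse depend continuously on M.\<close>

lemma matrix_inv_entry:
  fixes M :: "complex^'n^'n"
  assumes "det M \<noteq> 0"
  shows "matrix_inv M $ k $ l = det (\<chi> i j. if j = k then axis l 1 $ i else M $ i $ j) / det M"
proof -
  have "M ** matrix_inv M = mat 1"
    using assms by (simp add: matrix_inv_mult invertible_det_nz)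
  then have "M *v (matrix_inv M *v axis l 1) = axis l 1"
    by (simp add: matrix_vector_mul_assoc)
  then have "matrix_inv M *v axis l 1
      = (\<chi> k. det (\<chi> i j. if j = k then axis l 1 $ i else M $ i $ j) / det M)"
    using assms cramer by blast
  then have "(matrix_inv M *v axis l 1) $ k
      = det (\<chi> i j. if j = k then axis l 1 $ i else M $ i $ j) / det M"
    by simp
  moreover have "(matrix_inv M *v axis l 1) $ k = matrix_inv M $ k $ l"
    by (simp add: axis_def matrix_vector_mult_def if_distrib[of "\<lambda>a. _ * a"] sum.delta cong: if_cong)
  ultimately show ?thesis by simp
qed

lemma tendsto_matrix_inv:
  fixes f :: "nat \<Rightarrow> complex^'n^'n"
  assumes "f \<longlonglongrightarrow> M" "det M \<noteq> 0" "\<And>x. det (f x) \<noteq> 0"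
  shows "(\<lambda>x. matrix_inv (f x)) \<longlonglongrightarrow> matrix_inv M"
proof (intro vec_tendstoI)
  fix k l
  show "(\<lambda>x. matrix_inv (f x) $ k $ l) \<longlonglongrightarrow> matrix_inv M $ k $ l"
    unfolding matrix_inv_entry[OF assms(2)] matrix_inv_entry[OF assms(3)]
  proof (intro tendsto_divide tendsto_det assms vec_tendstoI)
    fix i j
    show "(\<lambda>x. (\<chi> i j. if j = k then axis l 1 $ i else f x $ i $ j) $ i $ j)
      \<longlonglongrightarrow> (\<chi> i j. if j = k then axis l 1 $ i else M $ i $ j) $ i $ j"
      by (cases "j = k") (auto intro!: tendsto_intros assms)
  qed
qed

lemma tendsto_matrix_mult:
  fixes f :: "'b \<Rightarrow> complex^'m^'n" and g :: "'b \<Rightarrow> complex^'k^'m"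
  assumes "(f \<longlongrightarrow> M) F" "(g \<longlongrightarrow> N) F"
  shows "((\<lambda>x. f x ** g x) \<longlongrightarrow> M ** N) F"
  unfolding matrix_matrix_mult_def by (intro vec_tendstoI, simp, intro tendsto_intros assms)

lemma tendsto_mconj:
  assumes "(f \<longlongrightarrow> M) F"
  shows "((\<lambda>x. mconj (f x)) \<longlongrightarrow> mconj M) F"
  unfolding mconj_def map_matrix_def by (intro vec_tendstoI, simp, intro tendsto_intros assms)


section \<open>Conjugate Stein inequalities\<close>

text \<open>The square of this antilinear map is \<^term>\<open>mhat T\<close>, and composing the Hermitian form of \<open>X\<close>
  with it gives the form of \<open>T\<^sup>H conj(X) T\<close>, so no conjugated matrices appear below.\<close>

definition conj_apply :: "complex^'n^'n \<Rightarrow> complex^'n \<Rightarrow> complex^'n" where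
  "conj_apply T v = vcnj (T *v v)"

lemma conj_apply_twice: "conj_apply T (conj_apply T v) = mhat T *v v"
  unfolding conj_apply_def mhat_def matrix_vector_mul_assoc[symmetric] mconj_mult_vec ..

lemma rquad_conj_congruence: "rquad (conj_transpose P ** mconj X ** P) v = rquad X (vcnj (P *v v))"
  by (simp add: rquad_congruence rquad_mconj)

lemma rquad_conj_stein: "rquad (conj_stein T X) v = rquad X v - rquad X (conj_apply T v)"
  by (simp add: conj_stein_def rquad_conj_congruence conj_apply_def)

text \<open>Two steps of the antilinear map are one step of \<open>mhat T\<close>, so the squared
  norm over k steps is of order s^k. Odd k are reduced to even ones by starting at
  \<open>conj_apply T v\<close>.\<close>

lemma conj_apply_funpow_growth:
  fixes T :: "complex^'n^'n"
  assumes "spec_radius (mhat T) < s"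
  obtains C where "0 < C" "\<And>k. (norm ((conj_apply T ^^ k) v))\<^sup>2 \<le> C * s ^ k"
proof -
  let ?\<tau> = "conj_apply T"
  have s: "0 < s" using assms spec_radius_nonneg[of "mhat T"] by linarith
  have even: "(?\<tau> ^^ (2 * j)) u = ((*v) (mhat T) ^^ j) u" for j u
    by (induction j) (auto simp: conj_apply_twice)
  obtain C0 where C0: "\<And>k. norm (((*v) (mhat T) ^^ k) v) \<le> C0 * s ^ k"
    using power_growth[OF assms] by blast
  obtain C1 where C1: "\<And>k. norm (((*v) (mhat T) ^^ k) (?\<tau> v)) \<le> C1 * s ^ k"
    using power_growth[OF assms] by blast
  \<comment> \<open>The summand 1 makes the constant positive; the division by s accounts for the
    odd case k = 2 j + 1, where the bound carries only s^(2 j).\<close>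
  have "(norm ((?\<tau> ^^ k) v))\<^sup>2 \<le> (1 + C0\<^sup>2 + C1\<^sup>2 / s) * s ^ k" for k
  proof (cases "even k")
    case True
    then obtain j where k: "k = 2 * j" by blast
    have "(norm ((?\<tau> ^^ k) v))\<^sup>2 \<le> (C0 * s ^ j)\<^sup>2"
      unfolding k even by (intro power_mono C0) auto
    also have "\<dots> = C0\<^sup>2 * s ^ k"
      by (simp add: k power_mult_distrib power_mult[symmetric] mult.commute)
    also have "\<dots> \<le> (1 + C0\<^sup>2 + C1\<^sup>2 / s) * s ^ k"
      using s by (intro mult_right_mono) auto
    finally show ?thesis .
  next
    case False
    then obtain j where k: "k = Suc (2 * j)" by (auto elim: oddE)
    have "(?\<tau> ^^ k) v = (?\<tau> ^^ (2 * j)) (?\<tau> v)"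
      by (simp add: k funpow_Suc_right del: funpow.simps)
    then have "(norm ((?\<tau> ^^ k) v))\<^sup>2 \<le> (C1 * s ^ j)\<^sup>2"
      unfolding even using C1[of j] by (simp add: power_mono)
    also have "\<dots> = C1\<^sup>2 / s * s ^ k"
      using s by (simp add: k power_mult_distrib power_mult[symmetric] mult.commute)
    also have "\<dots> \<le> (1 + C0\<^sup>2 + C1\<^sup>2 / s) * s ^ k"
      using s by (intro mult_right_mono) auto
    finally show ?thesis .
  qed
  moreover have "0 < 1 + C0\<^sup>2 + C1\<^sup>2 / s"
    using s by (simp add: add_pos_nonneg)
  ultimately show ?thesis using that by blast
qed

lemma rquad_funpow_growth:
  fixes T M :: "complex^'n^'n"
  assumes "spec_radius (mhat T) < s"
  obtains C where "0 < C" "\<And>k. \<bar>rquad M ((conj_apply T ^^ k) v)\<bar> \<le> C * s ^ k"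
proof -
  obtain K where K: "K \<ge> 0" "\<And>v. \<bar>rquad M v\<bar> \<le> K * (norm v)\<^sup>2"
    using rquad_bound by blast
  obtain C where C: "0 < C" "\<And>k. (norm ((conj_apply T ^^ k) v))\<^sup>2 \<le> C * s ^ k"
    using conj_apply_funpow_growth[OF assms] by blast
  have s: "0 < s" using assms spec_radius_nonneg[of "mhat T"] by linarith
  have "\<bar>rquad M ((conj_apply T ^^ k) v)\<bar> \<le> ((K + 1) * C) * s ^ k" for k
  proof -
    have "\<bar>rquad M ((conj_apply T ^^ k) v)\<bar> \<le> K * (norm ((conj_apply T ^^ k) v))\<^sup>2"
      by (rule K)
    \<comment> \<open>K may be 0; \<open>K + 1\<close> keeps the constant positive.\<close>
    also have "\<dots> \<le> (K + 1) * (C * s ^ k)"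
      using K(1) C s by (intro mult_mono) auto
    finally show ?thesis by (simp add: mult.assoc)
  qed
  moreover have "0 < (K + 1) * C" using K C by simp
  ultimately show ?thesis using that by blast
qed

lemma rquad_funpow_tendsto_0:
  fixes T M :: "complex^'n^'n"
  assumes "spec_radius (mhat T) < 1"
  shows "(\<lambda>k. rquad M ((conj_apply T ^^ k) v)) \<longlonglongrightarrow> 0"
proof -
  obtain s where s: "spec_radius (mhat T) < s" "s < 1"
    using assms dense by blast
  then have "0 < s" using spec_radius_nonneg[of "mhat T"] by linarith
  obtain C where C: "0 < C" "\<And>k. \<bar>rquad M ((conj_apply T ^^ k) v)\<bar> \<le> C * s ^ k"
    using rquad_funpow_growth[OF s(1)] by blast
  have "(\<lambda>k. C * s ^ k) \<longlonglongrightarrow> 0"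
    using \<open>0 < s\<close> s(2) by (intro tendsto_mult_right_zero LIMSEQ_realpow_zero) auto
  then show ?thesis
    by (rule Lim_null_comparison[rotated]) (auto intro!: always_eventually C(2))
qed

text \<open>By iteration the form does not increase along the orbit of v, while stability sends it
  to 0; the starting value is thus at least 0.\<close>

lemma stein_nonneg:
  fixes T D :: "complex^'n^'n"
  assumes "spec_radius (mhat T) < 1" "\<And>v. rquad D (conj_apply T v) \<le> rquad D v"
  shows "0 \<le> rquad D v"
proof (rule LIMSEQ_le_const2[OF rquad_funpow_tendsto_0[OF assms(1), of D v]], intro exI allI impI)
  fix k show "rquad D ((conj_apply T ^^ k) v) \<le> rquad D v"
    by (induction k) (auto intro: order_trans[OF assms(2)])
qed

text \<open>The Stein operator of a stable matrix is injective on the finite-dimensional real space of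
  Hermitian matrices, hence surjective.\<close>

lemma stein_solvable:
  fixes T Q :: "complex^'n^'n"
  assumes T: "spec_radius (mhat T) < 1" and Q: "hermitian Q"
  obtains X where "hermitian X" "conj_stein T X = Q"
proof -
  let ?V = "{X :: complex^'n^'n. hermitian X}"
  have sc: "(c *\<^sub>R M) ** N = c *\<^sub>R (M ** N)" "M ** (c *\<^sub>R N) = c *\<^sub>R (M ** N)"
    for c and M N :: "complex^'n^'n"
    by (simp_all add: vec_eq_iff matrix_matrix_mult_def scaleR_sum_right)
  have mc: "mconj (c *\<^sub>R M) = c *\<^sub>R mconj M" for c and M :: "complex^'n^'n"
    by (simp add: vec_eq_iff mconj_def map_matrix_def)
  have sub: "subspace ?V"
  proof (rule subspaceI)
    show "0 \<in> ?V"
      by (simp add: hermitian_def conj_transpose_def mconj_def map_matrix_def transpose_def vec_eq_iff)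
    show "x + y \<in> ?V" if "x \<in> ?V" "y \<in> ?V" for x y
      using that by (simp add: hermitian_add)
    show "c *\<^sub>R x \<in> ?V" if "x \<in> ?V" for c x
      using that by (simp add: hermitian_def conj_transpose_def mc transpose_scalar)
  qed
  have lin: "linear (conj_stein T)"
    by (rule linearI) (simp_all add: conj_stein_def matrix_add_ldistrib matrix_mult_add_rdistrib
        mc sc scaleR_diff_right)
  have "X = Y" if XY: "hermitian X" "hermitian Y" "conj_stein T X = conj_stein T Y" for X Y
  proof (rule hermitian_eqI[OF XY(1,2)])
    fix v
    have "conj_stein T (X - Y) = 0"
      using XY(3) linear_diff[OF lin] by simp
    \<comment> \<open>The form of X - Y is constant along orbits, yet stability forces it to tend to
      0 there.\<close>
    then have inv: "rquad (X - Y) (conj_apply T u) = rquad (X - Y) u" for u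
      using rquad_conj_stein[of T "X - Y" u] by simp
    have "rquad (X - Y) ((conj_apply T ^^ k) v) = rquad (X - Y) v" for k
      by (induction k) (simp_all only: funpow.simps inv comp_apply id_apply)
    then have "rquad (X - Y) v = 0"
      using rquad_funpow_tendsto_0[OF T, of "X - Y" v] by (simp only: LIMSEQ_const_iff)
    then show "rquad X v = rquad Y v" by simp
  qed
  then have inj: "inj_on (conj_stein T) ?V"
    by (auto simp: inj_on_def)
  have into: "conj_stein T ` ?V \<subseteq> ?V"
    by (auto simp: conj_stein_def intro!: hermitian_diff hermitian_congruence hermitian_mconj)
  have "dim (conj_stein T ` ?V) = dim ?V"
    using inj sub by (intro dim_image_eq[OF lin]) (simp add: span_eq_iff[THEN iffD2])
  then have "conj_stein T ` ?V = ?V"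
    by (intro subspace_dim_equal into sub linear_subspace_image lin) auto
  then have "Q \<in> conj_stein T ` ?V" using Q by simp
  then obtain X where "hermitian X" "Q = conj_stein T X" by auto
  then show ?thesis using that[of X] by simp
qed

text \<open>An eigenvector of \<^term>\<open>mhat T\<close> whose eigenvalue lies outside the open unit disc cannot
  feel the defect \<open>g\<close>, so it would also be an eigenvector of \<^term>\<open>mhat S\<close>.\<close>

lemma spec_radius_less_1_transfer:
  fixes S T D :: "complex^'n^'n" and g :: "complex^'n \<Rightarrow> real"
  assumes S: "spec_radius (mhat S) < 1"
    and D: "\<And>v. 0 \<le> rquad D v"
    and g: "\<And>v. 0 \<le> g v" "\<And>v. g v = 0 \<Longrightarrow> T *v v = S *v v"
    and le: "\<And>v. rquad D (conj_apply T v) + g v \<le> rquad D v"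
  shows "spec_radius (mhat T) < 1"
  unfolding spec_radius_less_iff
proof (rule ballI, rule ccontr)
  fix z assume "z \<in> matrix_spectrum (mhat T)" and z: "\<not> cmod z < 1"
  then obtain v where v: "v \<noteq> 0" "mhat T *v v = z *s v"
    by (auto simp: matrix_spectrum_def)
  let ?w = "conj_apply T v"
  \<comment> \<open>The inequality is used at v and at \<open>?w\<close>. After two steps the form
    has been multiplied by |z|^2 \<ge> 1, which leaves no room for either defect, so T and S agree
    at both vectors.\<close>
  have "rquad D (z *s v) + g ?w + g v \<le> rquad D v"
    using le[of v] le[of ?w] by (simp add: conj_apply_twice v(2))
  moreover have "rquad D v \<le> (cmod z)\<^sup>2 * rquad D v"
    using z D[of v] by (simp add: mult_le_cancel_right1)
  ultimately have "g ?w = 0" "g v = 0"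
    using g(1)[of ?w] g(1)[of v] by (simp_all add: rquad_scale)
  then have "conj_apply T ?w = conj_apply S ?w" "?w = conj_apply S v"
    by (simp_all add: conj_apply_def g(2))
  then have "mhat S *v v = z *s v"
    by (metis conj_apply_twice v(2))
  then have "z \<in> matrix_spectrum (mhat S)"
    using v(1) by (auto simp: matrix_spectrum_def)
  then show False using S z by (auto simp: spec_radius_less_iff)
qed

section \<open>From Hermitian forms to arbitrary norms and root rates\<close>

text \<open>M is expanded in the matrix units \<open>E i j\<close>; the triangle inequality and
  homogeneity do the rest. This one-sided comparison with the entries suffices for upper bounds on
  the rate.\<close>

lemma matrix_norm_bounded:
  fixes \<nu> :: "complex^'n^'n \<Rightarrow> real"
  assumes "matrix_norm \<nu>"
  obtains C where "\<And>M. \<nu> M \<le> C * (\<Sum>i\<in>UNIV. \<Sum>j\<in>UNIV. cmod (M $ i $ j))"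
proof -
  define E :: "'n \<Rightarrow> 'n \<Rightarrow> complex^'n^'n" where "E i j = axis i (axis j 1)" for i j
  have \<nu>: "\<And>M. 0 \<le> \<nu> M" "\<And>c M. \<nu> (mscale c M) = cmod c * \<nu> M" "\<And>M N. \<nu> (M + N) \<le> \<nu> M + \<nu> N" "\<nu> 0 = 0"
    using assms by (auto simp: matrix_norm_def)
  have tri: "\<nu> (sum f S) \<le> (\<Sum>x\<in>S. \<nu> (f x))" if "finite S" for f :: "'n \<Rightarrow> complex^'n^'n" and S
    using that by (induction S) (auto simp: \<nu>(4) intro: order_trans[OF \<nu>(3)])
  define C where "C = (\<Sum>i\<in>UNIV. \<Sum>j\<in>UNIV. \<nu> (E i j))"
  have EC: "\<nu> (E i j) \<le> C" for i j
  proof -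
    have "\<nu> (E i j) \<le> (\<Sum>j\<in>UNIV. \<nu> (E i j))"
      by (rule member_le_sum) (auto simp: \<nu>)
    also have "\<dots> \<le> C"
      unfolding C_def by (rule member_le_sum) (auto simp: \<nu> sum_nonneg)
    finally show ?thesis .
  qed
  have "\<nu> M \<le> C * (\<Sum>i\<in>UNIV. \<Sum>j\<in>UNIV. cmod (M $ i $ j))" for M
  proof -
    have if_sum: "(\<Sum>y\<in>S. if Q then f y else 0) = (if Q then sum f S else 0)"
      for Q and f :: "'n \<Rightarrow> complex" and S by simp
    have "M = (\<Sum>i\<in>UNIV. \<Sum>j\<in>UNIV. mscale (M $ i $ j) (E i j))"
      by (simp add: vec_eq_iff E_def mscale_def map_matrix_def axis_def if_distrib[of "\<lambda>a. a $ _"]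
          if_distrib[of "\<lambda>a. _ * a"] sum.delta if_sum cong: if_cong)
    then have "\<nu> M = \<nu> (\<Sum>i\<in>UNIV. \<Sum>j\<in>UNIV. mscale (M $ i $ j) (E i j))"
      by simp
    also have "\<dots> \<le> (\<Sum>i\<in>UNIV. \<Sum>j\<in>UNIV. \<nu> (mscale (M $ i $ j) (E i j)))"
      by (rule order_trans[OF tri]) (simp, intro sum_mono tri, simp)
    also have "\<dots> \<le> (\<Sum>i\<in>UNIV. \<Sum>j\<in>UNIV. C * cmod (M $ i $ j))"
      by (intro sum_mono) (simp add: \<nu>(2) mult.commute mult_right_mono EC)
    finally show ?thesis by (simp add: sum_distrib_left)
  qed
  then show ?thesis using that by blast
qed

lemma cmod_hermitian_entry_le:
  assumes "hermitian M"
  shows "cmod (M $ i $ j) \<le> \<bar>rquad M (axis i 1)\<bar> + \<bar>rquad M (axis j 1)\<bar>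
    + \<bar>rquad M (axis i 1 + axis j 1)\<bar> + \<bar>rquad M (axis i 1 + \<i> *s axis j 1)\<bar>"
proof -
  note e = hermitian_entry[OF assms, of i j]
  have "Re (M $ i $ j) = (rquad M (axis i 1 + axis j 1) - rquad M (axis i 1) - rquad M (axis j 1)) / 2"
    "Im (M $ i $ j) = (rquad M (axis i 1) + rquad M (axis j 1) - rquad M (axis i 1 + \<i> *s axis j 1)) / 2"
    using arg_cong[OF e, of Re] arg_cong[OF e, of Im] by simp_all
  moreover have "\<bar>(c - a - b) / 2\<bar> \<le> (\<bar>a\<bar> + \<bar>b\<bar>) / 2 + \<bar>c\<bar>" for a b c :: real
    by (auto simp: abs_if field_simps)
  moreover have "\<bar>(a + b - d) / 2\<bar> \<le> (\<bar>a\<bar> + \<bar>b\<bar>) / 2 + \<bar>d\<bar>" for a b d :: real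
    by (auto simp: abs_if field_simps)
  ultimately have "\<bar>Re (M $ i $ j)\<bar> \<le> (\<bar>rquad M (axis i 1)\<bar> + \<bar>rquad M (axis j 1)\<bar>) / 2
      + \<bar>rquad M (axis i 1 + axis j 1)\<bar>"
    and "\<bar>Im (M $ i $ j)\<bar> \<le> (\<bar>rquad M (axis i 1)\<bar> + \<bar>rquad M (axis j 1)\<bar>) / 2
      + \<bar>rquad M (axis i 1 + \<i> *s axis j 1)\<bar>"
    by (simp_all only:)
  then have "\<bar>Re (M $ i $ j)\<bar> + \<bar>Im (M $ i $ j)\<bar>
    \<le> ((\<bar>rquad M (axis i 1)\<bar> + \<bar>rquad M (axis j 1)\<bar>) / 2 + \<bar>rquad M (axis i 1 + axis j 1)\<bar>)
      + ((\<bar>rquad M (axis i 1)\<bar> + \<bar>rquad M (axis j 1)\<bar>) / 2 + \<bar>rquad M (axis i 1 + \<i> *s axis j 1)\<bar>)"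
    by (rule add_mono)
  then show ?thesis
    by (intro order_trans[OF cmod_le[of "M $ i $ j"]]) (simp add: field_simps)
qed

text \<open>The constants may depend on v because polarization uses only finitely many vectors,
  whose constants add up to a bound on all entries.\<close>

lemma matrix_norm_geometric:
  fixes \<nu> :: "complex^'n^'n \<Rightarrow> real" and D :: "nat \<Rightarrow> complex^'n^'n"
  assumes \<nu>: "matrix_norm \<nu>" and herm: "\<And>k. hermitian (D k)"
    and D: "\<And>v. \<exists>C. \<forall>k. \<bar>rquad (D k) v\<bar> \<le> C * s ^ k" and s: "0 < s"
  obtains C where "0 < C" "\<And>k. \<nu> (D k) \<le> C * s ^ k"
proof -
  obtain c where c: "\<And>v k. \<bar>rquad (D k) v\<bar> \<le> c v * s ^ k"
    using D by metis
  obtain K where K: "\<And>M. \<nu> M \<le> K * (\<Sum>i\<in>UNIV. \<Sum>j\<in>UNIV. cmod (M $ i $ j))"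
    using matrix_norm_bounded[OF \<nu>] by blast
  define e where "e i j = c (axis i 1) + c (axis j 1) + c (axis i 1 + axis j 1)
    + c (axis i 1 + \<i> *s axis j 1)" for i j
  have e: "cmod (D k $ i $ j) \<le> e i j * s ^ k" for i j k
    unfolding e_def distrib_right
    by (rule order_trans[OF cmod_hermitian_entry_le[OF herm]]) (intro add_mono c)
  let ?S = "\<Sum>i\<in>UNIV. \<Sum>j\<in>UNIV. e i j"
  \<comment> \<open>The absolute values cover the unknown signs of K and of the sum; the added 1
    makes the constant positive.\<close>
  have "\<nu> (D k) \<le> (\<bar>K\<bar> * \<bar>?S\<bar> + 1) * s ^ k" for k
  proof -
    have "\<nu> (D k) \<le> \<bar>K\<bar> * (\<Sum>i\<in>UNIV. \<Sum>j\<in>UNIV. cmod (D k $ i $ j))"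
      by (rule order_trans[OF K]) (intro mult_right_mono sum_nonneg, auto)
    also have "\<dots> \<le> \<bar>K\<bar> * (\<Sum>i\<in>UNIV. \<Sum>j\<in>UNIV. e i j * s ^ k)"
      by (intro mult_left_mono sum_mono e) auto
    also have "\<dots> = \<bar>K\<bar> * ?S * s ^ k"
      by (simp add: sum_distrib_right mult.assoc)
    also have "\<dots> \<le> (\<bar>K\<bar> * \<bar>?S\<bar> + 1) * s ^ k"
      using s by (intro mult_right_mono add_increasing2 mult_left_mono) auto
    finally show ?thesis .
  qed
  moreover have "0 < \<bar>K\<bar> * \<bar>?S\<bar> + 1" by (simp add: add_nonneg_pos)
  ultimately show ?thesis using that by blast
qed

text \<open>The factor C is invisible to the rate, as \<open>root k C\<close> tends to 1.\<close>

lemma root_rate_geometric: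
  assumes "\<And>k. 0 \<le> \<nu> (X k - L)" "\<And>k. \<nu> (X k - L) \<le> C * s ^ k" "0 < C" "0 < s"
  shows "root_rate \<nu> X L \<le> ereal s"
proof -
  have "(\<lambda>k. root k C * s) \<longlonglongrightarrow> 1 * s"
    by (intro tendsto_mult LIMSEQ_root_const assms tendsto_const)
  then have lim: "(\<lambda>k. ereal (root k C * s)) \<longlonglongrightarrow> ereal s"
    by simp
  have "root_rate \<nu> X L \<le> limsup (\<lambda>k. ereal (root k C * s))"
    unfolding root_rate_def
  \<comment> \<open>\<open>root 0\<close> is only a default value, so the comparison starts at k =
    1.\<close>
  proof (rule Limsup_mono, rule eventually_sequentiallyI[of 1])
    fix k :: nat assume k: "1 \<le> k"
    have "root k (\<nu> (X k - L)) \<le> root k (C * s ^ k)"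
      using k assms(2) by (intro real_root_le_mono) auto
    also have "\<dots> = root k C * s"
      using k assms(4) by (simp add: real_root_mult real_root_power_cancel)
    finally show "ereal (root k (\<nu> (X k - L))) \<le> ereal (root k C * s)" by simp
  qed
  also have "\<dots> = ereal s"
    using lim by (intro lim_imp_Limsup) auto
  finally show ?thesis .
qed


section \<open>Monotonicity of the Riccati iteration\<close>

locale cdare =
  fixes A H :: "complex^'n^'n" and B :: "complex^'m^'n" and R :: "complex^'m^'m"
  assumes R: "hermitian R" and H: "hermitian H"
begin

abbreviation "ric \<equiv> ric_op A B R H"
abbreviation "RX \<equiv> ric_R B R"
abbreviation "FX \<equiv> ric_F A B R"
abbreviation "TX \<equiv> ric_T A B R"
abbreviation "HX \<equiv> ric_H A B R H"
abbreviation "lower_set \<equiv> ric_le_set A B R H \<inter> P_set B R"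
abbreviation "stable_set \<equiv> T_set A B R"
abbreviation "upper_set \<equiv> S_ge_set A B R H"

lemma hermitian_RX: "hermitian X \<Longrightarrow> hermitian (RX X)"
  unfolding ric_R_def by (intro hermitian_add R hermitian_congruence hermitian_mconj)

lemma hermitian_HX: "hermitian (HX X)"
  unfolding ric_H_def by (intro hermitian_add R H hermitian_congruence)

lemma hermitian_ric:
  assumes "hermitian X" "det (RX X) \<noteq> 0"
  shows "hermitian (ric X)"
proof -
  have "conj_transpose (matrix_inv (RX X)) = matrix_inv (RX X)"
    using hermitian_matrix_inv[OF hermitian_RX[OF assms(1)]] assms(2)
    by (simp add: invertible_det_nz hermitian_def)
  then show ?thesis
    using assms(1) H by (simp add: hermitian_def ric_op_def conj_transpose_mult matrix_mul_assoc)
qed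

lemma rquad_RX: "rquad (RX X) u = rquad R u + rquad X (vcnj (B *v u))"
  by (simp add: ric_R_def rquad_conj_congruence)

lemma rquad_HX: "rquad (HX X) v = rquad H v + rquad R (FX X *v v)"
  by (simp add: ric_H_def rquad_congruence)

lemma TX_mult_vec: "TX X *v v = A *v v - B *v (FX X *v v)"
  by (simp add: ric_T_def matrix_vector_mult_diff_rdistrib matrix_vector_mul_assoc)

text \<open>Completion of the square, with the feedback \<open>f = F\<^sub>Y v\<close> of an arbitrary \<open>Y\<close> in place of the
  optimal one.\<close>

lemma rquad_ric:
  assumes X: "hermitian X" "det (RX X) \<noteq> 0"
  shows "rquad (ric X) v = rquad X (conj_apply (TX Y) v) + rquad (HX Y) v
    - rquad (RX X) (FX Y *v v - FX X *v v)"
proof -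
  define w where "w = A *v v"
  define f where "f = FX Y *v v"
  define g where "g = FX X *v v"
  define Z where "Z = mconj X"
  define S where "S = RX X"
  have Z: "cip (Z *v a) b = cip a (Z *v b)" for a b
    using X(1) by (simp add: Z_def cip_hermitian hermitian_mconj)
  have S: "cip (S *v a) b = cip a (S *v b)" for a b
    using X(1) by (simp add: S_def cip_hermitian hermitian_RX)
  \<comment> \<open>Normal equation of the optimal feedback g. It removes the inverse, so that the
    cross terms below are expressed through w, B f and B g.\<close>
  have Sg: "S *v g = conj_transpose B *v (Z *v w)"
    using matrix_inv_mult(1)[of "RX X"] X(2)
    by (simp add: g_def ric_F_def S_def Z_def w_def matrix_vector_mul_assoc matrix_mul_assoc invertible_det_nz)
  have Sf: "S *v f = R *v f + conj_transpose B *v (Z *v (B *v f))"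
    by (simp add: S_def ric_R_def Z_def matrix_vector_mult_add_rdistrib
        matrix_vector_mul_assoc matrix_mul_assoc)
  have "ric X *v v = conj_transpose A *v (Z *v w) - conj_transpose A *v (Z *v (B *v g)) + H *v v"
    by (simp add: ric_op_def g_def ric_F_def Z_def w_def matrix_vector_mult_add_rdistrib
        matrix_vector_mult_diff_rdistrib matrix_vector_mul_assoc matrix_mul_assoc)
  then have 1: "quad_form (ric X) v = cip w (Z *v w) - cip w (Z *v (B *v g)) + quad_form H v"
    by (simp add: quad_form_cip cip_conj_transpose[symmetric] w_def)
  have fg: "cip f (S *v g) = cip (B *v f) (Z *v w)"
    by (simp add: Sg cip_conj_transpose)
  have gf: "cip g (S *v f) = cip w (Z *v (B *v f))"
    unfolding S[symmetric] Sg by (metis Z cip_conj_transpose conj_transpose_simps(1))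
  have gg: "cip g (S *v g) = cip w (Z *v (B *v g))"
    by (subst S[symmetric], unfold Sg) (metis Z cip_conj_transpose conj_transpose_simps(1))
  have ff: "cip f (S *v f) = quad_form R f + cip (B *v f) (Z *v (B *v f))"
    by (simp add: Sf quad_form_cip cip_conj_transpose)
  have 2: "quad_form S (f - g) = quad_form R f + cip (B *v f) (Z *v (B *v f))
      - cip (B *v f) (Z *v w) - cip w (Z *v (B *v f)) + cip w (Z *v (B *v g))"
    by (simp add: quad_form_cip matrix_vector_mult_diff_distrib fg gf gg ff)
  \<comment> \<open>Conjugating the vector amounts to conjugating X, so this term is the form of Z
    at A v - B f.\<close>
  have 3: "rquad X (conj_apply (TX Y) v) = Re (cip (w - B *v f) (Z *v (w - B *v f)))"
    unfolding conj_apply_def rquad_mconj[symmetric]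
    by (simp add: TX_mult_vec w_def f_def Z_def rquad_def quad_form_cip)
  show ?thesis
    unfolding rquad_HX 3 unfolding rquad_def f_def[symmetric] g_def[symmetric] S_def[symmetric] 1 2
    by (simp add: matrix_vector_mult_diff_distrib)
qed

lemma TX_mult_vec_cong: "FX X *v v = FX Y *v v \<Longrightarrow> TX X *v v = TX Y *v v"
  by (simp add: TX_mult_vec)

lemma lower_setD:
  assumes "P \<in> lower_set"
  shows "hermitian P" "pos_definite (RX P)" "det (RX P) \<noteq> 0" "rquad P v \<le> rquad (ric P) v"
proof -
  show P: "hermitian P" "pos_definite (RX P)" "det (RX P) \<noteq> 0"
    using assms by (auto simp: P_set_def ric_le_set_def pos_definite_det)
  show "rquad P v \<le> rquad (ric P) v"
    using assms P by (auto simp: ric_le_set_def loewner_le_iff hermitian_ric)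
qed

lemma lower_setI:
  assumes "hermitian P" "pos_definite (RX P)" "ric P = P"
  shows "P \<in> lower_set"
  using assms by (auto simp: P_set_def ric_le_set_def ric_dom_def pos_definite_det loewner_le_iff)

lemma stable_setD:
  assumes "Y \<in> stable_set"
  shows "hermitian Y" "det (RX Y) \<noteq> 0" "spec_radius (mhat (TX Y)) < 1"
  using assms by (auto simp: T_set_def ric_dom_def)

lemma upper_set_iff:
  "X \<in> upper_set \<longleftrightarrow> hermitian X \<and>
    (\<exists>Y\<in>stable_set. \<forall>v. rquad X (conj_apply (TX Y) v) + rquad (HX Y) v \<le> rquad X v)"
proof -
  have "HX Y \<preceq>\<^sub>L conj_stein (TX Y) X
      \<longleftrightarrow> (\<forall>v. rquad X (conj_apply (TX Y) v) + rquad (HX Y) v \<le> rquad X v)" if "hermitian X" for Y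
    using that by (subst loewner_le_iff)
      (auto simp: hermitian_HX conj_stein_def rquad_conj_congruence conj_apply_def algebra_simps
        intro!: hermitian_diff hermitian_congruence hermitian_mconj)
  then show ?thesis
    unfolding S_ge_set_def by blast
qed

section \<open>Comparison of the upper and the lower set\<close>

text \<open>X enters \<open>RX X\<close> only through a congruence of its conjugate, so raising X
  raises the form of \<open>RX X\<close>.\<close>

lemma pos_definite_RX_mono:
  assumes "hermitian X" "pos_definite (RX P)" "\<And>v. rquad P v \<le> rquad X v"
  shows "pos_definite (RX X)"
  unfolding pos_definite_iff
proof (intro conjI allI impI)
  fix v :: "complex^'m" assume "v \<noteq> 0"
  then have "0 < rquad (RX P) v"
    using assms(2) by (simp add: pos_definite_iff)
  also have "\<dots> \<le> rquad (RX X) v"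
    using assms(3) by (simp add: rquad_RX)
  finally show "0 < rquad (RX X) v" .
qed (rule hermitian_RX[OF assms(1)])

text \<open>With the feedback of a stable Y, completing the square for P drops a nonnegative term,
  so P satisfies the Stein inequality opposite to that of X. Subtraction leaves a homogeneous
  inequality for X - P.\<close>

lemma upper_above_lower:
  assumes X: "X \<in> upper_set" and P: "P \<in> lower_set"
  shows "rquad P v \<le> rquad X v"
proof -
  obtain Y where Y: "Y \<in> stable_set"
    "\<And>v. rquad X (conj_apply (TX Y) v) + rquad (HX Y) v \<le> rquad X v"
    using X by (auto simp: upper_set_iff)
  have "0 \<le> rquad (X - P) v"
  proof (rule stein_nonneg[OF stable_setD(3)[OF Y(1)]])
    fix v
    have "rquad P v \<le> rquad (ric P) v"
      by (rule lower_setD[OF P])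
    also have "\<dots> \<le> rquad P (conj_apply (TX Y) v) + rquad (HX Y) v"
      using rquad_ric[OF lower_setD(1,3)[OF P], of v Y] pos_definite_rquad(1)[OF lower_setD(2)[OF P]]
      by simp
    finally show "rquad (X - P) (conj_apply (TX Y) v) \<le> rquad (X - P) v"
      using Y(2)[of v] by simp
  qed
  then show ?thesis by simp
qed

context
  fixes P assumes P: "P \<in> lower_set"
begin

text \<open>The fixed P bounds X from below, which makes \<open>RX X\<close> positive definite.
  Stability is carried over from Y with D = X - P; the defect measures how far the feedback of Y is
  from the optimal one at X.\<close>

lemma upper_setD:
  assumes X: "X \<in> upper_set"
  shows "hermitian X" "pos_definite (RX X)" "det (RX X) \<noteq> 0"
    "rquad (ric X) v \<le> rquad X v" "spec_radius (mhat (TX X)) < 1"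
proof -
  obtain Y where Y: "Y \<in> stable_set"
    "\<And>v. rquad X (conj_apply (TX Y) v) + rquad (HX Y) v \<le> rquad X v"
    using X by (auto simp: upper_set_iff)
  show herm: "hermitian X" using X by (simp add: upper_set_iff)
  show pd: "pos_definite (RX X)"
    by (rule pos_definite_RX_mono[OF herm lower_setD(2)[OF P] upper_above_lower[OF X P]])
  show det: "det (RX X) \<noteq> 0"
    by (rule pos_definite_det[OF pd])
  let ?g = "\<lambda>v. rquad (RX X) (FX Y *v v - FX X *v v)"
  have le: "rquad (ric X) v + ?g v \<le> rquad X v" for v
    using rquad_ric[OF herm det, of v Y] Y(2)[of v] by simp
  show "rquad (ric X) v \<le> rquad X v"
    using le[of v] pos_definite_rquad(1)[OF pd, of "FX Y *v v - FX X *v v"] by simp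
  show "spec_radius (mhat (TX X)) < 1"
  proof (rule spec_radius_less_1_transfer[where g = ?g and D = "X - P", OF stable_setD(3)[OF Y(1)]])
    show "0 \<le> rquad (X - P) v" for v
      using upper_above_lower[OF X P, of v] by simp
    show "0 \<le> ?g v" for v
      by (rule pos_definite_rquad(1)[OF pd])
    show "TX X *v v = TX Y *v v" if "?g v = 0" for v
      using pos_definite_rquad(2)[OF pd that] by (intro TX_mult_vec_cong) simp
    fix v
    have "rquad (ric X) v = rquad X (conj_apply (TX X) v) + rquad (HX X) v"
      using rquad_ric[OF herm det, of v X] by simp
    \<comment> \<open>For P the feedback of X need not be optimal, so dropping its square gives an
      upper bound. For X, in the equality above, the same feedback is optimal and no square
      appears.\<close>
    moreover have "rquad P v \<le> rquad P (conj_apply (TX X) v) + rquad (HX X) v"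
      using rquad_ric[OF lower_setD(1,3)[OF P], of v X] lower_setD(4)[OF P, of v]
        pos_definite_rquad(1)[OF lower_setD(2)[OF P], of "FX X *v v - FX P *v v"] by simp
    ultimately show "rquad (X - P) (conj_apply (TX X) v) + ?g v \<le> rquad (X - P) v"
      using le[of v] by simp
  qed
qed

lemma upper_subset: "upper_set \<subseteq> ric_ge_set A B R H \<inter> P_set B R \<inter> stable_set"
  by (auto simp: ric_ge_set_def P_set_def T_set_def ric_dom_def upper_setD hermitian_ric loewner_le_iff)

text \<open>X itself replaces Y as witness: it is stable, and with its own feedback the square
  vanishes. What remains is \<open>ric X\<close> \<le> X, evaluated along
  \<open>TX X\<close>.\<close>

lemma ric_upper:
  assumes X: "X \<in> upper_set"
  shows "ric X \<in> upper_set"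
  unfolding upper_set_iff
proof (intro conjI bexI allI)
  show "hermitian (ric X)" by (intro hermitian_ric upper_setD X)
  show "X \<in> stable_set" using X upper_subset by auto
  fix v
  show "rquad (ric X) (conj_apply (TX X) v) + rquad (HX X) v \<le> rquad (ric X) v"
    using rquad_ric[OF upper_setD(1,3)[OF X], of v X] upper_setD(4)[OF X, of "conj_apply (TX X) v"]
    by simp
qed

text \<open>The Stein equation of a stable Y, solved with equality, yields a starting
  matrix.\<close>

lemma upper_nonempty:
  assumes "stable_set \<noteq> {}"
  shows "upper_set \<noteq> {}"
proof -
  obtain Y where Y: "Y \<in> stable_set" using assms by blast
  obtain X where X: "hermitian X" "conj_stein (TX Y) X = HX Y"
    using stein_solvable[OF stable_setD(3)[OF Y] hermitian_HX] by blast
  have "rquad (HX Y) v = rquad X v - rquad X (conj_apply (TX Y) v)" for v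
    unfolding X(2)[symmetric] by (rule rquad_conj_stein)
  then have "X \<in> upper_set"
    unfolding upper_set_iff using X(1) Y by (intro conjI bexI[of _ Y]) auto
  then show ?thesis by blast
qed

section \<open>Limit and rate of the iteration\<close>

context
  fixes X0 assumes X0: "X0 \<in> upper_set"
begin

abbreviation "iter \<equiv> ric_iterate A B R H X0"

lemma iter_Suc: "iter (Suc k) = ric (iter k)"
  by (simp add: ric_iterate_def)

lemma iter_upper: "iter k \<in> upper_set"
  by (induction k) (simp_all add: X0 ric_upper iter_Suc, simp add: ric_iterate_def X0)

lemmas iterD = upper_setD[OF iter_upper]

lemma iter_decreasing: "rquad (iter (Suc k)) v \<le> rquad (iter k) v"
  unfolding iter_Suc by (rule iterD(4))

lemma iter_above: "Q \<in> lower_set \<Longrightarrow> rquad Q v \<le> rquad (iter k) v"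
  by (rule upper_above_lower[OF iter_upper])

text \<open>The forms decrease and stay above those of P, hence converge. Once \<open>RX L\<close>
  is known to be invertible, \<open>ric\<close> passes to the limit; strict stability may be lost
  there, leaving only the bound 1.\<close>

lemma iter_limit:
  obtains L where "iter \<longlonglongrightarrow> L" "hermitian L" "pos_definite (RX L)" "ric L = L"
    "\<forall>Q\<in>lower_set. \<forall>v. rquad Q v \<le> rquad L v" "spec_radius (mhat (TX L)) \<le> 1"
proof -
  have conv: "convergent (\<lambda>k. rquad (iter k) v)" for v
  proof (rule Bseq_monoseq_convergent)
    have dec: "decseq (\<lambda>k. rquad (iter k) v)"
      by (simp add: decseq_Suc_iff iter_decreasing)
    then show "monoseq (\<lambda>k. rquad (iter k) v)"
      by (rule decseq_imp_monoseq)
    show "Bseq (\<lambda>k. rquad (iter k) v)"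
      by (rule decseq_bounded[OF dec]) (auto intro: iter_above[OF P])
  qed
  obtain L where L: "iter \<longlonglongrightarrow> L" "hermitian L"
    using hermitian_tendsto[of iter, OF iterD(1) conv] by blast
  have above: "rquad Q v \<le> rquad L v" if Q: "Q \<in> lower_set" for Q v
    by (rule LIMSEQ_le_const[OF rquad_tendsto[OF L(1)]]) (use iter_above[OF Q] in blast)
  \<comment> \<open>Positivity of \<open>RX (iter k)\<close> alone could degenerate in the limit;
    domination of P preserves it.\<close>
  have pd: "pos_definite (RX L)"
    by (rule pos_definite_RX_mono[OF L(2) lower_setD(2)[OF P] above[OF P]])
  have "(\<lambda>k. RX (iter k)) \<longlonglongrightarrow> RX L"
    unfolding ric_R_def by (intro tendsto_intros tendsto_matrix_mult tendsto_mconj L)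
  then have inv: "(\<lambda>k. matrix_inv (RX (iter k))) \<longlonglongrightarrow> matrix_inv (RX L)"
    by (rule tendsto_matrix_inv[OF _ pos_definite_det[OF pd] iterD(3)])
  have "(\<lambda>k. ric (iter k)) \<longlonglongrightarrow> ric L"
    unfolding ric_op_def by (intro tendsto_intros tendsto_matrix_mult tendsto_mconj L inv)
  moreover have "(\<lambda>k. ric (iter k)) \<longlonglongrightarrow> L"
    using LIMSEQ_Suc[OF L(1)] by (simp only: iter_Suc)
  ultimately have fixpoint: "ric L = L"
    by (rule LIMSEQ_unique)
  have "(\<lambda>k. mhat (TX (iter k))) \<longlonglongrightarrow> mhat (TX L)"
    unfolding mhat_def ric_T_def ric_F_def
    by (intro tendsto_intros tendsto_matrix_mult tendsto_mconj L inv)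
  then have "spec_radius (mhat (TX L)) \<le> 1"
    by (rule spec_radius_limit_le_1) (rule iterD(5))
  then show ?thesis
    using that L pd fixpoint above by blast
qed

text \<open>Using the feedback of the fixed point L and dropping the square, each error is dominated
  by the previous one evaluated along \<open>TX L\<close>. Errors are nonnegative, so bounding them
  from above suffices.\<close>

lemma iter_geometric:
  assumes L: "L \<in> lower_set" "ric L = L" and s: "spec_radius (mhat (TX L)) < s"
    and \<nu>: "matrix_norm \<nu>"
  obtains C where "0 < C" "\<And>k. \<nu> (iter k - L) \<le> C * s ^ k"
proof -
  let ?D = "\<lambda>k. iter k - L" and ?\<tau> = "conj_apply (TX L)"
  have nonneg: "0 \<le> rquad (?D k) v" for k v
    using iter_above[OF L(1), of v k] by simp
  have step: "rquad (?D (Suc k)) v \<le> rquad (?D k) (?\<tau> v)" for k v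
  proof -
    have "rquad (iter (Suc k)) v \<le> rquad (iter k) (?\<tau> v) + rquad (HX L) v"
      using rquad_ric[OF iterD(1,3), of k v L]
        pos_definite_rquad(1)[OF iterD(2), of k "FX L *v v - FX (iter k) *v v"]
      by (simp add: iter_Suc)
    moreover have "rquad L v = rquad L (?\<tau> v) + rquad (HX L) v"
      using rquad_ric[OF lower_setD(1,3)[OF L(1)], of v L] by (simp add: L(2))
    ultimately show ?thesis by simp
  qed
  \<comment> \<open>The vector is generalized because each step moves it by
    \<open>?\<tau>\<close>.\<close>
  have dom: "rquad (?D k) v \<le> rquad (?D 0) ((?\<tau> ^^ k) v)" for k v
  proof (induction k arbitrary: v)
    case (Suc k)
    have "rquad (?D (Suc k)) v \<le> rquad (?D k) (?\<tau> v)" by (rule step)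
    also have "\<dots> \<le> rquad (?D 0) ((?\<tau> ^^ k) (?\<tau> v))" by (rule Suc)
    finally show ?case by (simp add: funpow_Suc_right del: funpow.simps)
  qed simp
  have "\<exists>C. \<forall>k. \<bar>rquad (?D k) v\<bar> \<le> C * s ^ k" for v
  proof -
    obtain C where "\<And>k. \<bar>rquad (?D 0) ((?\<tau> ^^ k) v)\<bar> \<le> C * s ^ k"
      using rquad_funpow_growth[OF s] by blast
    then have "\<bar>rquad (?D k) v\<bar> \<le> C * s ^ k" for k
      using dom[of k v] nonneg[of k v] by (smt (verit))
    then show ?thesis by blast
  qed
  moreover have "hermitian (?D k)" for k
    by (intro hermitian_diff iterD lower_setD(1)[OF L(1)])
  moreover have "0 < s" using s spec_radius_nonneg[of "mhat (TX L)"] by linarith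
  ultimately show ?thesis
    using matrix_norm_geometric[OF \<nu>, of ?D s] that by blast
qed

text \<open>A geometric bound is at hand for each s strictly above the spectral radius; the rate
  follows by letting s approach it.\<close>

lemma iter_rate:
  assumes L: "L \<in> lower_set" "ric L = L" and \<nu>: "matrix_norm \<nu>"
  shows "root_rate \<nu> iter L \<le> ereal (spec_radius (mhat (TX L)))"
proof (rule dense_ge)
  fix y assume y: "ereal (spec_radius (mhat (TX L))) < y"
  obtain s where s: "ereal (spec_radius (mhat (TX L))) < ereal s" "ereal s < y"
    using ereal_dense2[OF y] by blast
  then have s': "spec_radius (mhat (TX L)) < s" by simp
  obtain C where C: "0 < C" "\<And>k. \<nu> (iter k - L) \<le> C * s ^ k"
    using iter_geometric[OF L s' \<nu>] by blast
  have "0 < s" using s' spec_radius_nonneg[of "mhat (TX L)"] by linarith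
  then have "root_rate \<nu> iter L \<le> ereal s"
    using \<nu> C by (intro root_rate_geometric[where C = C]) (auto simp: matrix_norm_def)
  with s(2) show "root_rate \<nu> iter L \<le> y" by order
qed

lemma iter_at_least_linear:
  assumes L: "L \<in> lower_set" "ric L = L" and \<nu>: "matrix_norm \<nu>"
    and stable: "spec_radius (mhat (TX L)) < 1"
  shows "at_least_linear \<nu> iter L"
proof -
  obtain s where s: "spec_radius (mhat (TX L)) < s" "s < 1"
    using stable dense by blast
  obtain C where C: "0 < C" "\<And>k. \<nu> (iter k - L) \<le> C * s ^ k"
    using iter_geometric[OF L s(1) \<nu>] by blast
  have "0 < s" using s spec_radius_nonneg[of "mhat (TX L)"] by linarith
  then have "(\<lambda>k. C * s ^ k) \<longlonglongrightarrow> 0"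
    using s(2) by (intro tendsto_mult_right_zero LIMSEQ_realpow_zero) auto
  then have "(\<lambda>k. \<nu> (iter k - L)) \<longlonglongrightarrow> 0"
    by (rule Lim_null_comparison[rotated]) (use \<nu> C(2) in \<open>auto simp: matrix_norm_def\<close>)
  moreover have "root_rate \<nu> iter L < 1"
    using iter_rate[OF L \<nu>] stable by (metis ereal_less(3) le_less_trans)
  ultimately show ?thesis by (simp add: at_least_linear_def)
qed

end

end

end

section \<open>Existence of the maximal solution and convergence from every start\<close>

theorem theorem3p1:
  fixes A H :: "complex^'n^'n" and B :: "complex^'m^'n" and R :: "complex^'m^'m"
  assumes "hermitian R" and "invertible R" and "hermitian H"
    and "T_set A B R \<noteq> {}"
    and "ric_le_set A B R H \<inter> P_set B R \<noteq> {}"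
  shows "\<exists>X\<^sub>M. cdare_maximal_solution A B R H X\<^sub>M
    \<and> S_ge_set A B R H \<inter> T_set A B R \<subseteq> ric_ge_set A B R H \<inter> P_set B R \<inter> T_set A B R
    \<and> maximal_element (ric_le_set A B R H \<inter> P_set B R) X\<^sub>M
    \<and> spec_radius (mhat (ric_T A B R X\<^sub>M)) \<le> 1
    \<and> (\<forall>X\<^sub>0 \<in> S_ge_set A B R H.
         (\<forall>k. ric_iterate A B R H X\<^sub>0 k \<in> ric_dom B R)
       \<and> (\<forall>k. ric_iterate A B R H X\<^sub>0 k \<in> S_ge_set A B R H \<inter> T_set A B R)
       \<and> (\<forall>k. \<forall>X\<^sub>P \<in> ric_le_set A B R H \<inter> P_set B R.
             ric_iterate A B R H X\<^sub>0 (Suc k) \<preceq>\<^sub>L ric_iterate A B R H X\<^sub>0 k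
           \<and> X\<^sub>P \<preceq>\<^sub>L ric_iterate A B R H X\<^sub>0 (Suc k))
       \<and> ric_iterate A B R H X\<^sub>0 \<longlonglongrightarrow> X\<^sub>M
       \<and> (X\<^sub>M \<in> T_set A B R \<longrightarrow>
            (\<forall>\<nu>. matrix_norm \<nu> \<longrightarrow>
                at_least_linear \<nu> (ric_iterate A B R H X\<^sub>0) X\<^sub>M
              \<and> root_rate \<nu> (ric_iterate A B R H X\<^sub>0) X\<^sub>M
                  \<le> ereal (spec_radius (mhat (ric_T A B R X\<^sub>M))))))"
proof -
  interpret cdare A H B R
    using assms by unfold_locales
  obtain P where P: "P \<in> lower_set"
    using assms by blast
  obtain Y where Y: "Y \<in> upper_set"
    using upper_nonempty[OF P assms(4)] by blast
  \<comment> \<open>L comes from one particular start; its independence of that choice is shown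
    below.\<close>
  obtain L where "ric_iterate A B R H Y \<longlonglongrightarrow> L" and L: "hermitian L" "pos_definite (RX L)" "ric L = L"
    "\<forall>Q\<in>lower_set. \<forall>v. rquad Q v \<le> rquad L v" "spec_radius (mhat (TX L)) \<le> 1"
    by (rule iter_limit[OF P Y])
  have L_lower: "L \<in> lower_set"
    by (rule lower_setI) (fact L)+
  have above: "Q \<preceq>\<^sub>L L" if "Q \<in> lower_set" for Q
    using that L(1,4) lower_setD(1)[OF that] by (simp add: loewner_le_iff)
  have max: "maximal_element lower_set L"
    using L_lower above by (simp add: maximal_element_def)
  \<comment> \<open>Every solution lies in \<open>lower_set\<close> by \<open>lower_setI\<close>, so
    dominance over that set covers all solutions.\<close>
  have sol: "cdare_maximal_solution A B R H L"
    using L(1-3) above lower_setI by (auto simp: cdare_maximal_solution_def cdare_solution_def)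
  have iterate: "(\<forall>k. ric_iterate A B R H X0 k \<in> ric_dom B R)
       \<and> (\<forall>k. ric_iterate A B R H X0 k \<in> upper_set \<inter> stable_set)
       \<and> (\<forall>k. \<forall>Q\<in>lower_set. ric_iterate A B R H X0 (Suc k) \<preceq>\<^sub>L ric_iterate A B R H X0 k
           \<and> Q \<preceq>\<^sub>L ric_iterate A B R H X0 (Suc k))
       \<and> ric_iterate A B R H X0 \<longlonglongrightarrow> L
       \<and> (L \<in> stable_set \<longrightarrow> (\<forall>\<nu>. matrix_norm \<nu> \<longrightarrow> at_least_linear \<nu> (ric_iterate A B R H X0) L
              \<and> root_rate \<nu> (ric_iterate A B R H X0) L \<le> ereal (spec_radius (mhat (TX L)))))"
    if X0: "X0 \<in> upper_set" for X0
  proof (intro conjI allI ballI impI)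
    note D = iterD[OF P X0]
    fix k
    show dom: "ric_iterate A B R H X0 k \<in> ric_dom B R"
      using D by (simp add: ric_dom_def)
    show "ric_iterate A B R H X0 k \<in> upper_set \<inter> stable_set"
      using iter_upper[OF P X0] D dom by (simp add: T_set_def)
    show "ric_iterate A B R H X0 (Suc k) \<preceq>\<^sub>L ric_iterate A B R H X0 k"
      using D(1) iter_decreasing[OF P X0] by (simp add: loewner_le_iff)
    show "Q \<preceq>\<^sub>L ric_iterate A B R H X0 (Suc k)" if Q: "Q \<in> lower_set" for Q
      using D(1) iter_above[OF P X0 Q] lower_setD(1)[OF Q] by (simp add: loewner_le_iff)
  next
    obtain L' where L': "ric_iterate A B R H X0 \<longlonglongrightarrow> L'" "hermitian L'" "pos_definite (RX L')"
      "ric L' = L'" "\<forall>Q\<in>lower_set. \<forall>v. rquad Q v \<le> rquad L' v"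
      "spec_radius (mhat (TX L')) \<le> 1"
      by (rule iter_limit[OF P X0])
    have "L' \<in> lower_set"
      by (rule lower_setI) (fact L')+
    \<comment> \<open>Both limits lie in \<open>lower_set\<close> and each dominates that set, so
      their forms agree by antisymmetry.\<close>
    then have "L' = L"
      using L' L L_lower by (intro hermitian_eqI antisym) auto
    with L' show "ric_iterate A B R H X0 \<longlonglongrightarrow> L" by simp
  next
    fix \<nu> :: "complex^'n^'n \<Rightarrow> real" assume "L \<in> stable_set" and \<nu>: "matrix_norm \<nu>"
    then show "at_least_linear \<nu> (ric_iterate A B R H X0) L"
      by (intro iter_at_least_linear[OF P X0] L_lower L stable_setD)
    show "root_rate \<nu> (ric_iterate A B R H X0) L \<le> ereal (spec_radius (mhat (TX L)))"
      by (rule iter_rate[OF P X0 L_lower L(3) \<nu>])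
  qed
  have "upper_set \<inter> stable_set \<subseteq> ric_ge_set A B R H \<inter> P_set B R \<inter> stable_set"
    using upper_subset[OF P] by blast
  then show ?thesis
    by (intro exI[of _ L] conjI[OF sol] conjI[OF _ conjI[OF max]] conjI[OF L(5)] ballI iterate)
qed

end
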